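(* Let $H,K$ be complex Banach spaces, let $A_0,A_1\in\mathcal L(H,K)$ with $A_0$ singular, and let $A(z)=A_0+A_1z$ for $z\in\mathbb C$. Let $s,r\in\mathbb R$ with $0\le s<r$ and $\mathcal U_{s,r}=\{z\in\mathbb C:s<|z|<r\}$. The resolvent $R(z)=A(z)^{-1}$ is defined and analytic as a map $R:\mathcal U_{s,r}\to\mathcal L(K,H)$ if and only if there exist $R_{-1},R_0\in\mathcal L(K,H)$ such that (i) $R_{-1}A_1+R_0A_0=I$ on $H$ and $A_1R_{-1}+A_0R_0=I$ on $K$; (ii) $R_{-1}A_iR_0=0$ and $R_0A_iR_{-1}=0$ for each $i=0,1$; (iii) $\lim_{j\to\infty}\|(R_{-1}A_0)^j\|^{1/j}\le s$ and $\lim_{j\to\infty}\|(R_0A_1)^j\|^{1/j}\le1/r$. If these conditions are satisfied then $R_{-1},R_0$ are uniquely defined and, with $P=R_{-1}A_1\in\mathcal L(H)$ and $Q=A_1R_{-1}\in\mathcal L(K)$, for all $z\in\mathcal U_{s,r}$, $$R(z)=R_{[0]}(z)+R_{[0]}^c(z),$$ where $$R_{[0]}(z)=PR(z)Q=(Iz+R_{-1}A_0)^{-1}R_{-1},\qquad R_{[0]}^c(z)=(I-P)R(z)(I-Q)=(I+R_0A_1z)^{-1}R_0 .$$ Moreover, in that case, if $\mathcal R_\lambda\in\mathcal L(H)$ and $\mathcal S_\lambda\in\mathcal L(K)$ are defined by $\mathcal R_\lambda=\lambda^{-1}R(-\lambda^{-1})A_0$ and $\mathcal S_\lambda=\lambda^{-1}A_0R(-\lambda^{-1})$,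 then $$\mathcal R_\lambda-\mathcal R_\mu=(\mu-\lambda)\mathcal R_\lambda\mathcal R_\mu\quad\text{and}\quad \mathcal S_\lambda-\mathcal S_\mu=(\mu-\lambda)\mathcal S_\lambda\mathcal S_\mu$$ for all $\lambda,\mu\in\mathcal U_{r^{-1},s^{-1}}=\{\lambda\in\mathbb C: r^{-1}<|\lambda|<s^{-1}\}$.
   Context: $\mathcal L(H,K)$ denotes the bounded linear operators from $H$ to $K$ with the operator norm, and $\mathcal L(H)=\mathcal L(H,H)$. "$A_0$ is singular" means that $A_0$ has no inverse in $\mathcal L(K,H)$. The resolvent being defined at $z$ means that $A(z)$ has a two-sided inverse $R(z)\in\mathcal L(K,H)$. $I$ denotes the identity operator on $H$ or $K$ as appropriate. When $s=0$, $s^{-1}$ is read as $\infty$. *)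

theory Defs
  imports "HOL-Analysis.Analysis"
begin

section \<open>Complex Banach spaces\<close>

text \<open>A complex normed space is a real normed space together with a complex scalar multiplication
  that extends the real one, so that the library's topology and Frechet derivative apply to it.
  The law \<open>1 *\<^sub>C x = x\<close> follows from compatibility with \<open>*\<^sub>R\<close>.\<close>

class complex_normed_vector = real_normed_vector +
  fixes scaleC :: "complex \<Rightarrow> 'a \<Rightarrow> 'a" (infixr "*\<^sub>C" 75)
  assumes scaleC_add_right: "c *\<^sub>C (x + y) = c *\<^sub>C x + c *\<^sub>C y"
    and scaleC_add_left: "(c + d) *\<^sub>C x = c *\<^sub>C x + d *\<^sub>C x"
    and scaleC_scaleC: "c *\<^sub>C (d *\<^sub>C x) = (c * d) *\<^sub>C x"
    and scaleC_of_real: "complex_of_real t *\<^sub>C x = t *\<^sub>R x"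
    and norm_scaleC: "norm (c *\<^sub>C x) = cmod c * norm x"

class complex_banach = complex_normed_vector + banach

instantiation complex :: complex_banach
begin

definition scaleC_complex :: "complex \<Rightarrow> complex \<Rightarrow> complex"
  where "scaleC_complex c x = c * x"

instance
  by standard (auto simp: scaleC_complex_def algebra_simps norm_mult scaleR_conv_of_real)

end

lemma scaleC_zero_right [simp]: "c *\<^sub>C (0::'a::complex_normed_vector) = 0"
  using scaleC_add_right[of c 0 "0::'a"] by simp

lemma scaleC_minus_right: "c *\<^sub>C (- x) = - (c *\<^sub>C (x::'a::complex_normed_vector))"
  using scaleC_add_right[of c x "- x"] by (simp add: eq_neg_iff_add_eq_0 add.commute)

lemma scaleC_diff_right: "c *\<^sub>C (x - y) = c *\<^sub>C x - c *\<^sub>C (y::'a::complex_normed_vector)"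
  using scaleC_add_right[of c x "- y"] by (simp add: scaleC_minus_right)

lemma scaleC_scaleR_commute:
  "c *\<^sub>C (t *\<^sub>R x) = t *\<^sub>R (c *\<^sub>C (x::'a::complex_normed_vector))"
  by (simp add: scaleC_of_real[symmetric] scaleC_scaleC mult.commute)

lemma bounded_linear_scaleC_right: "bounded_linear (\<lambda>x::'a::complex_normed_vector. c *\<^sub>C x)"
  by (rule bounded_linear_intro[where K = "cmod c"])
    (simp_all add: scaleC_add_right scaleC_scaleR_commute norm_scaleC mult.commute)


section \<open>Bounded complex-linear operators\<close>

definition bounded_clinear :: "('a::complex_normed_vector \<Rightarrow> 'b::complex_normed_vector) \<Rightarrow> bool"
  where "bounded_clinear f \<longleftrightarrow> bounded_linear f \<and> (\<forall>c x. f (c *\<^sub>C x) = c *\<^sub>C f x)"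

typedef (overloaded) ('a, 'b) cblinfun ("(_ \<Rightarrow>\<^sub>C\<^sub>L /_)" [22, 21] 21) =
  "{f::'a::complex_normed_vector \<Rightarrow> 'b::complex_normed_vector. bounded_clinear f}"
  morphisms cblinfun_apply CBlinfun
  by (rule exI[of _ "\<lambda>_. 0"]) (simp add: bounded_clinear_def)

setup_lifting type_definition_cblinfun

lemma cblinfun_eqI: "(\<And>x. cblinfun_apply f x = cblinfun_apply g x) \<Longrightarrow> f = g"
  by transfer auto

instantiation cblinfun :: (complex_normed_vector, complex_normed_vector) complex_normed_vector
begin

lift_definition norm_cblinfun :: "'a \<Rightarrow>\<^sub>C\<^sub>L 'b \<Rightarrow> real" is onorm .

lift_definition zero_cblinfun :: "'a \<Rightarrow>\<^sub>C\<^sub>L 'b" is "\<lambda>x. 0"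
  by (simp add: bounded_clinear_def)

lift_definition plus_cblinfun :: "'a \<Rightarrow>\<^sub>C\<^sub>L 'b \<Rightarrow> 'a \<Rightarrow>\<^sub>C\<^sub>L 'b \<Rightarrow> 'a \<Rightarrow>\<^sub>C\<^sub>L 'b" is "\<lambda>f g x. f x + g x"
  by (simp add: bounded_clinear_def bounded_linear_add scaleC_add_right)

lift_definition minus_cblinfun :: "'a \<Rightarrow>\<^sub>C\<^sub>L 'b \<Rightarrow> 'a \<Rightarrow>\<^sub>C\<^sub>L 'b \<Rightarrow> 'a \<Rightarrow>\<^sub>C\<^sub>L 'b" is "\<lambda>f g x. f x - g x"
  by (simp add: bounded_clinear_def bounded_linear_sub scaleC_diff_right)

lift_definition uminus_cblinfun :: "'a \<Rightarrow>\<^sub>C\<^sub>L 'b \<Rightarrow> 'a \<Rightarrow>\<^sub>C\<^sub>L 'b" is "\<lambda>f x. - f x"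
  by (simp add: bounded_clinear_def bounded_linear_minus scaleC_minus_right)

lift_definition scaleR_cblinfun :: "real \<Rightarrow> 'a \<Rightarrow>\<^sub>C\<^sub>L 'b \<Rightarrow> 'a \<Rightarrow>\<^sub>C\<^sub>L 'b" is "\<lambda>t f x. t *\<^sub>R f x"
  by (auto simp: bounded_clinear_def scaleC_scaleR_commute
      intro: bounded_linear_compose[OF bounded_linear_scaleR_right])

lift_definition scaleC_cblinfun :: "complex \<Rightarrow> 'a \<Rightarrow>\<^sub>C\<^sub>L 'b \<Rightarrow> 'a \<Rightarrow>\<^sub>C\<^sub>L 'b" is "\<lambda>c f x. c *\<^sub>C f x"
  by (auto simp: bounded_clinear_def scaleC_scaleC mult.commute
      intro: bounded_linear_compose[OF bounded_linear_scaleC_right])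

definition dist_cblinfun :: "'a \<Rightarrow>\<^sub>C\<^sub>L 'b \<Rightarrow> 'a \<Rightarrow>\<^sub>C\<^sub>L 'b \<Rightarrow> real"
  where "dist_cblinfun f g = norm (f - g)"

definition sgn_cblinfun :: "'a \<Rightarrow>\<^sub>C\<^sub>L 'b \<Rightarrow> 'a \<Rightarrow>\<^sub>C\<^sub>L 'b"
  where "sgn_cblinfun f = inverse (norm f) *\<^sub>R f"

definition uniformity_cblinfun :: "(('a \<Rightarrow>\<^sub>C\<^sub>L 'b) \<times> ('a \<Rightarrow>\<^sub>C\<^sub>L 'b)) filter"
  where "uniformity_cblinfun = (INF e\<in>{0<..}. principal {(f, g). dist f g < e})"

definition open_cblinfun :: "('a \<Rightarrow>\<^sub>C\<^sub>L 'b) set \<Rightarrow> bool"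
  where "open_cblinfun S = (\<forall>f\<in>S. \<forall>\<^sub>F (f', g) in uniformity. f' = f \<longrightarrow> g \<in> S)"

lemma onorm_scaleC_le:
  assumes "bounded_linear (f::'a \<Rightarrow> 'b)"
  shows "onorm (\<lambda>x. c *\<^sub>C f x) \<le> cmod c * onorm f"
  by (rule onorm_bound)
    (auto simp: norm_scaleC onorm_pos_le[OF assms] mult.assoc intro: mult_left_mono onorm[OF assms])

lemma onorm_scaleC:
  assumes f: "bounded_linear (f::'a \<Rightarrow> 'b)"
  shows "onorm (\<lambda>x. c *\<^sub>C f x) = cmod c * onorm f"
proof (cases "c = 0")
  case True
  have "0 *\<^sub>C f x = 0" for x
    using scaleC_of_real[of 0 "f x"] by simp
  with True show ?thesis
    by (simp add: onorm_zero)
next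
  case False
  have cf: "bounded_linear (\<lambda>x. c *\<^sub>C f x)"
    by (rule bounded_linear_compose[OF bounded_linear_scaleC_right f])
  have "1 *\<^sub>C f x = f x" for x
    using scaleC_of_real[of 1 "f x"] by simp
  with False have "onorm f = onorm (\<lambda>x. inverse c *\<^sub>C (c *\<^sub>C f x))"
    by (simp add: scaleC_scaleC)
  also have "\<dots> \<le> cmod (inverse c) * onorm (\<lambda>x. c *\<^sub>C f x)"
    by (rule onorm_scaleC_le[OF cf])
  finally have "cmod c * onorm f \<le> onorm (\<lambda>x. c *\<^sub>C f x)"
    using False by (simp add: norm_inverse) (simp add: field_simps)
  with onorm_scaleC_le[OF f] show ?thesis
    by (rule antisym)
qed

instance
  apply standard
  unfolding dist_cblinfun_def open_cblinfun_def sgn_cblinfun_def uniformity_cblinfun_def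
  apply (rule refl |
      (transfer, force simp: bounded_clinear_def onorm_triangle onorm_scaleR onorm_eq_0
        onorm_scaleC scaleC_add_right scaleC_add_left scaleC_scaleC scaleC_of_real algebra_simps))+
  done

end

lift_definition cblinfun_id :: "'a::complex_normed_vector \<Rightarrow>\<^sub>C\<^sub>L 'a" is "\<lambda>x. x"
  by (simp add: bounded_clinear_def)

lift_definition cblinfun_compose ::
  "'b::complex_normed_vector \<Rightarrow>\<^sub>C\<^sub>L 'c::complex_normed_vector \<Rightarrow> 'a::complex_normed_vector \<Rightarrow>\<^sub>C\<^sub>L 'b \<Rightarrow> 'a \<Rightarrow>\<^sub>C\<^sub>L 'c"
  (infixl "o\<^sub>C" 67) is "\<lambda>f g x. f (g x)"
  by (auto simp: bounded_clinear_def intro: bounded_linear_compose)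

primrec cblinfun_power :: "'a::complex_normed_vector \<Rightarrow>\<^sub>C\<^sub>L 'a \<Rightarrow> nat \<Rightarrow> 'a \<Rightarrow>\<^sub>C\<^sub>L 'a" where
  "cblinfun_power T 0 = cblinfun_id"
| "cblinfun_power T (Suc n) = T o\<^sub>C cblinfun_power T n"

definition cblinfun_is_inverse ::
  "'a::complex_normed_vector \<Rightarrow>\<^sub>C\<^sub>L 'b::complex_normed_vector \<Rightarrow> 'b \<Rightarrow>\<^sub>C\<^sub>L 'a \<Rightarrow> bool"
  where "cblinfun_is_inverse T S \<longleftrightarrow> S o\<^sub>C T = cblinfun_id \<and> T o\<^sub>C S = cblinfun_id"

definition cblinfun_invertible :: "'a::complex_normed_vector \<Rightarrow>\<^sub>C\<^sub>L 'b::complex_normed_vector \<Rightarrow> bool"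
  where "cblinfun_invertible T \<longleftrightarrow> (\<exists>S. cblinfun_is_inverse T S)"

text \<open>Unspecified when the operator is not invertible; see \<open>cblinfun_inv_eqI\<close> otherwise.\<close>

definition cblinfun_inv :: "'a::complex_normed_vector \<Rightarrow>\<^sub>C\<^sub>L 'b::complex_normed_vector \<Rightarrow> 'b \<Rightarrow>\<^sub>C\<^sub>L 'a"
  where "cblinfun_inv T = (THE S. cblinfun_is_inverse T S)"

lemma cblinfun_is_inverse_unique:
  assumes "cblinfun_is_inverse T S" "cblinfun_is_inverse T S'"
  shows "S = S'"
proof -
  have "S = S o\<^sub>C (T o\<^sub>C S')"
    using assms(2) unfolding cblinfun_is_inverse_def by (metis cblinfun_compose.rep_eq
        cblinfun_eqI cblinfun_id.rep_eq)
  also have "\<dots> = (S o\<^sub>C T) o\<^sub>C S'"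
    by transfer simp
  also have "\<dots> = S'"
    using assms(1) unfolding cblinfun_is_inverse_def by (metis cblinfun_compose.rep_eq
        cblinfun_eqI cblinfun_id.rep_eq)
  finally show ?thesis .
qed

lemma cblinfun_inv_eqI: "cblinfun_is_inverse T S \<Longrightarrow> cblinfun_inv T = S"
  unfolding cblinfun_inv_def by (blast intro: cblinfun_is_inverse_unique)


section \<open>Analytic operator-valued functions\<close>

text \<open>These are \<open>holomorphic_on\<close> and \<open>analytic_on\<close> of the library with values in an arbitrary
  complex normed space instead of \<open>complex\<close>: the Frechet derivative has to be multiplication by a
  complex scalar, and the limit is taken in norm.\<close>

definition vholomorphic_on :: "(complex \<Rightarrow> 'a::complex_normed_vector) \<Rightarrow> complex set \<Rightarrow> bool"
    (infixl "vholomorphic'_on" 50)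
  where "f vholomorphic_on S \<longleftrightarrow> (\<forall>z\<in>S. \<exists>D. (f has_derivative (\<lambda>h. h *\<^sub>C D)) (at z within S))"

definition vanalytic_on :: "(complex \<Rightarrow> 'a::complex_normed_vector) \<Rightarrow> complex set \<Rightarrow> bool"
    (infixl "vanalytic'_on" 50)
  where "f vanalytic_on S \<longleftrightarrow> (\<forall>z\<in>S. \<exists>\<epsilon>>0. f vholomorphic_on ball z \<epsilon>)"


section \<open>Linear pencils and their resolvents\<close>

definition pencil ::
  "'h::complex_normed_vector \<Rightarrow>\<^sub>C\<^sub>L 'k::complex_normed_vector \<Rightarrow> 'h \<Rightarrow>\<^sub>C\<^sub>L 'k \<Rightarrow> complex \<Rightarrow> 'h \<Rightarrow>\<^sub>C\<^sub>L 'k"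
  where "pencil A\<^sub>0 A\<^sub>1 z = A\<^sub>0 + z *\<^sub>C A\<^sub>1"

definition resolvent ::
  "'h::complex_normed_vector \<Rightarrow>\<^sub>C\<^sub>L 'k::complex_normed_vector \<Rightarrow> 'h \<Rightarrow>\<^sub>C\<^sub>L 'k \<Rightarrow> complex \<Rightarrow> 'k \<Rightarrow>\<^sub>C\<^sub>L 'h"
  where "resolvent A\<^sub>0 A\<^sub>1 z = cblinfun_inv (pencil A\<^sub>0 A\<^sub>1 z)"

text \<open>The radii are extended reals because the outer radius may be \<open>inverse (ereal 0) = \<infinity>\<close>.\<close>

definition annulus :: "ereal \<Rightarrow> ereal \<Rightarrow> complex set"
  where "annulus a b = {z. a < ereal (cmod z) \<and> ereal (cmod z) < b}"

text \<open>\<open>Rm\<close> stands for the coefficient \<open>R\<close> with index \<open>-1\<close>.\<close>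

definition basic_solution ::
  "'h::complex_normed_vector \<Rightarrow>\<^sub>C\<^sub>L 'k::complex_normed_vector \<Rightarrow> 'h \<Rightarrow>\<^sub>C\<^sub>L 'k \<Rightarrow> real \<Rightarrow> real
    \<Rightarrow> 'k \<Rightarrow>\<^sub>C\<^sub>L 'h \<Rightarrow> 'k \<Rightarrow>\<^sub>C\<^sub>L 'h \<Rightarrow> bool"
  where "basic_solution A\<^sub>0 A\<^sub>1 s r Rm R\<^sub>0 \<longleftrightarrow>
    (Rm o\<^sub>C A\<^sub>1 + R\<^sub>0 o\<^sub>C A\<^sub>0 = cblinfun_id \<and> A\<^sub>1 o\<^sub>C Rm + A\<^sub>0 o\<^sub>C R\<^sub>0 = cblinfun_id) \<and>
    (\<forall>A\<in>{A\<^sub>0, A\<^sub>1}. Rm o\<^sub>C A o\<^sub>C R\<^sub>0 = 0 \<and> R\<^sub>0 o\<^sub>C A o\<^sub>C Rm = 0) \<and>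
    (\<exists>l\<le>s. (\<lambda>j. root j (norm (cblinfun_power (Rm o\<^sub>C A\<^sub>0) j))) \<longlonglongrightarrow> l) \<and>
    (\<exists>l\<le>1 / r. (\<lambda>j. root j (norm (cblinfun_power (R\<^sub>0 o\<^sub>C A\<^sub>1) j))) \<longlonglongrightarrow> l)"

end

theory Submission
  imports Defs
begin

text \<open>Given the two inverses \<open>Z = (z I + R\<^bsub>-1\<^esub> A\<^sub>0)\<^sup>-\<^sup>1\<close> and \<open>Y = (I + z R\<^sub>0 A\<^sub>1)\<^sup>-\<^sup>1\<close>, which
  exist by the root test, conditions (i) and (ii) show directly that \<open>Z R\<^bsub>-1\<^esub> + Y R\<^sub>0\<close> inverts
  \<open>A\<^sub>0 + z A\<^sub>1\<close>.

  Conversely, let \<open>R\<^sub>n\<close> be the Laurent coefficients of the resolvent, defined as means over circles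
  and independent of the radius. Comparing coefficients in \<open>A(z) R(z) = I\<close> and \<open>R(z) A(z) = I\<close> and
  eliminating \<open>R\<^sub>m A\<^sub>0 R\<^sub>n\<close> gives \<open>R\<^sub>m A\<^sub>1 R\<^bsub>n-1\<^esub> = R\<^bsub>m-1\<^esub> A\<^sub>1 R\<^sub>n\<close> for \<open>m, n \<noteq> 0\<close>. Moving along such an
  antidiagonal to infinity, the Cauchy estimates on two different circles force
  \<open>R\<^sub>i A\<^sub>1 R\<^sub>j = 0\<close> for \<open>i < 0 \<le> j\<close> and for \<open>j < 0 \<le> i\<close>; no double contour integral is needed. Then
  \<open>(R\<^bsub>-1\<^esub> A\<^sub>0)\<^sup>k\<^sup>+\<^sup>1 = (-1)\<^sup>k R\<^bsub>-k-1\<^esub> A\<^sub>0\<close> and \<open>(R\<^sub>0 A\<^sub>1)\<^sup>k\<^sup>+\<^sup>1 = (-1)\<^sup>k R\<^sub>k A\<^sub>1\<close>, so that (iii) is again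
  a Cauchy estimate.\<close>

section \<open>Operators on complex Banach spaces\<close>

declare [[coercion cblinfun_apply]]

lemma scaleC_one [simp]: "1 *\<^sub>C x = (x::'a::complex_normed_vector)"
  using scaleC_of_real[of 1 x] by simp

lemma scaleC_zero_left [simp]: "0 *\<^sub>C x = (0::'a::complex_normed_vector)"
  using scaleC_of_real[of 0 x] by simp

lemma scaleC_minus_left: "(- c) *\<^sub>C x = - (c *\<^sub>C (x::'a::complex_normed_vector))"
  using scaleC_add_left[of c "- c" x] by (simp add: add_eq_0_iff)

lemma scaleC_diff_left: "(c - d) *\<^sub>C x = c *\<^sub>C x - d *\<^sub>C (x::'a::complex_normed_vector)"
  using scaleC_add_left[of c "- d" x] by (simp add: scaleC_minus_left)

lemmas scaleC_ring_simps =
  scaleC_add_right scaleC_add_left scaleC_diff_right scaleC_diff_left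
  scaleC_minus_right scaleC_minus_left scaleC_scaleC

text \<open>Makes the general limit, continuity and product rules for bounded bilinear maps
  available for complex scalars.\<close>

lemma bounded_bilinear_scaleC:
  "bounded_bilinear (\<lambda>c (x::'a::complex_normed_vector). c *\<^sub>C x)"
proof (rule bounded_bilinear.intro)
  show "(r *\<^sub>R c) *\<^sub>C x = r *\<^sub>R (c *\<^sub>C x)" for r c and x :: 'a
    by (simp add: scaleR_conv_of_real scaleC_scaleC[symmetric] scaleC_of_real)
qed (auto simp: scaleC_add_right scaleC_add_left scaleC_scaleR_commute norm_scaleC intro: exI[of _ 1])

lemma bounded_linear_cblinfun: "bounded_linear (cblinfun_apply f)"
  using cblinfun_apply[of f] by (simp add: bounded_clinear_def)

lemma cblinfun_scaleC_right: "cblinfun_apply f (c *\<^sub>C x) = c *\<^sub>C cblinfun_apply f x"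
  using cblinfun_apply[of f] by (simp add: bounded_clinear_def)

lemmas cblinfun_linear_simps =
  linear_add[OF bounded_linear.linear[OF bounded_linear_cblinfun]]
  linear_diff[OF bounded_linear.linear[OF bounded_linear_cblinfun]]
  linear_neg[OF bounded_linear.linear[OF bounded_linear_cblinfun]]
  linear_0[OF bounded_linear.linear[OF bounded_linear_cblinfun]]
  cblinfun_scaleC_right

lemmas cblinfun_apply_simps =
  plus_cblinfun.rep_eq minus_cblinfun.rep_eq uminus_cblinfun.rep_eq zero_cblinfun.rep_eq
  scaleC_cblinfun.rep_eq cblinfun_compose.rep_eq cblinfun_id.rep_eq

lemma norm_cblinfun_compose: "norm (f o\<^sub>C g) \<le> norm f * norm g"
  unfolding norm_cblinfun.rep_eq cblinfun_compose.rep_eq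
  using onorm_compose[OF bounded_linear_cblinfun[of f] bounded_linear_cblinfun[of g]]
  by (simp add: o_def)

lemma bounded_bilinear_cblinfun_compose: "bounded_bilinear (o\<^sub>C)"
  by (rule bounded_bilinear.intro)
    (auto intro!: cblinfun_eqI exI[of _ 1] norm_cblinfun_compose
      simp: cblinfun_apply_simps cblinfun_linear_simps scaleR_cblinfun.rep_eq
        linear_scale[OF bounded_linear.linear[OF bounded_linear_cblinfun]])

lemma cblinfun_compose_assoc: "f o\<^sub>C (g o\<^sub>C h) = f o\<^sub>C g o\<^sub>C h"
  by (rule cblinfun_eqI) (simp add: cblinfun_apply_simps)

lemma cblinfun_compose_id [simp]: "f o\<^sub>C cblinfun_id = f" "cblinfun_id o\<^sub>C f = f"
  by (auto intro: cblinfun_eqI simp: cblinfun_apply_simps)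

lemma cblinfun_compose_scaleC:
  "(c *\<^sub>C f) o\<^sub>C g = c *\<^sub>C (f o\<^sub>C g)" "f o\<^sub>C (c *\<^sub>C g) = c *\<^sub>C (f o\<^sub>C g)"
  by (auto intro!: cblinfun_eqI simp: cblinfun_apply_simps cblinfun_linear_simps)

lemmas cblinfun_compose_simps =
  bounded_bilinear.add_left[OF bounded_bilinear_cblinfun_compose]
  bounded_bilinear.add_right[OF bounded_bilinear_cblinfun_compose]
  bounded_bilinear.diff_left[OF bounded_bilinear_cblinfun_compose]
  bounded_bilinear.diff_right[OF bounded_bilinear_cblinfun_compose]
  bounded_bilinear.minus_left[OF bounded_bilinear_cblinfun_compose]
  bounded_bilinear.minus_right[OF bounded_bilinear_cblinfun_compose]
  bounded_bilinear.zero_left[OF bounded_bilinear_cblinfun_compose]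
  bounded_bilinear.zero_right[OF bounded_bilinear_cblinfun_compose]
  cblinfun_compose_scaleC

text \<open>Completeness is inherited from the real bounded operators, among which the complex-linear
  ones form a closed subspace.\<close>

instance cblinfun :: (complex_normed_vector, complex_banach) complex_banach
proof
  fix X :: "nat \<Rightarrow> 'a \<Rightarrow>\<^sub>C\<^sub>L 'b"
  assume X: "Cauchy X"
  define B where "B f = Blinfun (cblinfun_apply f)" for f :: "'a \<Rightarrow>\<^sub>C\<^sub>L 'b"
  have B: "blinfun_apply (B f) = cblinfun_apply f" for f
    by (simp add: B_def bounded_linear_Blinfun_apply bounded_linear_cblinfun)
  have "dist (B f) (B g) = dist f g" for f g
    by (simp add: dist_norm norm_blinfun.rep_eq minus_blinfun.rep_eq B norm_cblinfun.rep_eq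
        minus_cblinfun.rep_eq)
  then have "Cauchy (\<lambda>n. B (X n))"
    using X by (simp add: Cauchy_def)
  then obtain L where L: "(\<lambda>n. B (X n)) \<longlonglongrightarrow> L"
    using Cauchy_convergent convergent_def by blast
  then have Lx: "(\<lambda>n. cblinfun_apply (X n) x) \<longlonglongrightarrow> blinfun_apply L x" for x
    using bounded_linear.tendsto[OF blinfun.bounded_linear_left[of x] L] by (simp add: B)
  \<comment> \<open>Norm convergence gives pointwise convergence, and multiplication by
    \<open>c\<close> is continuous, so complex homogeneity passes to the limit.\<close>
  have "blinfun_apply L (c *\<^sub>C x) = c *\<^sub>C blinfun_apply L x" for c x
    using Lx[of "c *\<^sub>C x"] bounded_linear.tendsto[OF bounded_linear_scaleC_right Lx, of c x]
    by (intro LIMSEQ_unique[of "\<lambda>n. cblinfun_apply (X n) (c *\<^sub>C x)"])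
      (auto simp: cblinfun_scaleC_right)
  then have LC: "cblinfun_apply (CBlinfun (blinfun_apply L)) = blinfun_apply L"
    by (intro CBlinfun_inverse)
      (auto simp: bounded_clinear_def blinfun.bounded_linear_right)
  have "norm (X n - CBlinfun (blinfun_apply L)) = norm (B (X n) - L)" for n
    by (simp add: norm_blinfun.rep_eq minus_blinfun.rep_eq B norm_cblinfun.rep_eq
        minus_cblinfun.rep_eq LC)
  then have "X \<longlonglongrightarrow> CBlinfun (blinfun_apply L)"
    using L by (simp add: tendsto_iff dist_norm)
  then show "convergent X"
    by (auto simp: convergent_def)
qed

section \<open>Powers of an operator\<close>

lemma cblinfun_power_add:
  "cblinfun_power T (m + n) = cblinfun_power T m o\<^sub>C cblinfun_power T n"
  by (induction m) (simp_all add: cblinfun_compose_assoc)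

lemma cblinfun_power_commute: "cblinfun_power T n o\<^sub>C T = T o\<^sub>C cblinfun_power T n"
  by (induction n) (simp_all flip: cblinfun_compose_assoc)

lemma cblinfun_power_scaleC: "cblinfun_power (c *\<^sub>C T) n = c ^ n *\<^sub>C cblinfun_power T n"
  by (induction n) (simp_all add: cblinfun_compose_simps scaleC_scaleC mult.commute)

lemma norm_cblinfun_power_add_le:
  "norm (cblinfun_power T (m + n)) \<le> norm (cblinfun_power T m) * norm (cblinfun_power T n)"
  by (simp add: cblinfun_power_add norm_cblinfun_compose)

lemma norm_cblinfun_power_le: "norm (cblinfun_power T (m * k + j))
  \<le> norm (cblinfun_power T m) ^ k * norm (cblinfun_power T j)"
proof (induction k)
  case (Suc k)
  have "norm (cblinfun_power T (m + (m * k + j)))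
      \<le> norm (cblinfun_power T m) * (norm (cblinfun_power T m) ^ k * norm (cblinfun_power T j))"
    using norm_cblinfun_power_add_le[of T m "m * k + j"] mult_left_mono[OF Suc norm_ge_zero[of "cblinfun_power T m"]]
    by linarith
  then show ?case
    by (simp add: algebra_simps)
qed simp

section \<open>Spectral radius and Neumann series\<close>

lemma eventually_root_less:
  fixes a :: "nat \<Rightarrow> real"
  assumes "\<And>n. a n \<le> B * q ^ n" and "\<And>n. 0 \<le> a n" and "0 \<le> q" and "q < q'"
  shows "\<forall>\<^sub>F n in sequentially. root n (a n) < q'"
proof -
  \<comment> \<open>Enlarging \<open>B\<close> keeps the bound and makes the constant positive, so
    that its \<open>n\<close>-th root tends to 1.\<close>
  define C where "C = max B 1"
  have "(\<lambda>n. root n C * q) \<longlonglongrightarrow> 1 * q"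
    by (intro tendsto_mult LIMSEQ_root_const tendsto_const) (simp add: C_def)
  then have lim: "\<forall>\<^sub>F n in sequentially. root n C * q < q'"
    using assms(4) by (auto dest: order_tendstoD(2))
  have root_le: "root n (a n) \<le> root n C * q" if "n > 0" for n
  proof -
    have "a n \<le> C * q ^ n"
      using assms(1)[of n] assms(3) by (smt (verit) C_def mult_right_mono zero_le_power)
    then have "root n (a n) \<le> root n (C * q ^ n)"
      using that by simp
    also have "\<dots> = root n C * q"
      using that assms(3) by (simp add: real_root_mult real_root_power_cancel)
    finally show ?thesis .
  qed
  from lim eventually_gt_at_top[of "0::nat"] show ?thesis
    by eventually_elim (blast intro: le_less_trans root_le)
qed

text \<open>Fekete's argument: writing \<open>n = m k + j\<close> with \<open>j < m\<close> gives
  \<open>\<parallel>T\<^sup>n\<parallel> \<le> C q\<^sup>n\<close> as soon as \<open>\<parallel>T\<^sup>m\<parallel> \<le> q\<^sup>m\<close>.\<close>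

lemma root_norm_power_convergent:
  "\<exists>l\<ge>0. (\<lambda>j. root j (norm (cblinfun_power T j))) \<longlonglongrightarrow> l"
proof -
  define a where "a n = norm (cblinfun_power T n)" for n
  \<comment> \<open>Index 0 is left out: \<open>root 0\<close> is 0 by convention and would pull the
    infimum down to 0.\<close>
  define l where "l = Inf ((\<lambda>n. root n (a n)) ` {0<..})"
  have a: "a n \<ge> 0" for n
    by (simp add: a_def)
  have bdd: "bdd_below ((\<lambda>n. root n (a n)) ` {0<..})"
    by (rule bdd_belowI[of _ 0]) (auto simp: a real_root_ge_zero)
  have l0: "l \<ge> 0"
    unfolding l_def by (rule cInf_greatest) (auto simp: a real_root_ge_zero)
  have le: "l \<le> root n (a n)" if "n > 0" for n
    unfolding l_def using that by (intro cInf_lower bdd) auto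
  have less: "\<forall>\<^sub>F n in sequentially. root n (a n) < q'" if "l < q'" for q'
  proof -
    obtain q where q: "l < q" "q < q'"
      using \<open>l < q'\<close> dense by blast
    obtain m where m: "m > 0" "root m (a m) < q"
      using cInf_lessD[of "(\<lambda>n. root n (a n)) ` {0<..}" q] q by (auto simp: l_def)
    have "q > 0"
      using q l0 by simp
    have am: "a m \<le> q ^ m"
      using m a \<open>q > 0\<close>
      by (metis less_imp_le power_mono real_root_ge_zero real_root_pow_pos2)
    \<comment> \<open>The remainder \<open>j\<close> takes only finitely many values, so one
      constant serves them all.\<close>
    define B where "B = Max ((\<lambda>j. a j / q ^ j) ` {..<m})"
    have "a n \<le> B * q ^ n" for n
    proof -
      define j where "j = n mod m"
      define k where "k = n div m"
      have n: "n = m * k + j" "j < m"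
        using m by (auto simp: j_def k_def)
      have "a j / q ^ j \<le> B"
        unfolding B_def using n(2) by (intro Max_ge) auto
      then have aj: "a j \<le> B * q ^ j"
        using \<open>q > 0\<close> by (simp add: field_simps)
      have "a n \<le> a m ^ k * a j"
        unfolding n a_def by (rule norm_cblinfun_power_le)
      also have "\<dots> \<le> (q ^ m) ^ k * (B * q ^ j)"
        using am aj a \<open>q > 0\<close> by (intro mult_mono power_mono) auto
      also have "\<dots> = B * q ^ n"
        by (simp add: n(1) power_add power_mult)
      finally show ?thesis .
    qed
    from eventually_root_less[OF this a _ q(2)] show ?thesis
      using \<open>q > 0\<close> by simp
  qed
  have "(\<lambda>n. root n (a n)) \<longlonglongrightarrow> l"
  proof (rule order_tendstoI)
    fix x assume "x < l"
    show "\<forall>\<^sub>F n in sequentially. x < root n (a n)"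
      using eventually_gt_at_top[of "0::nat"] by eventually_elim (blast intro: less_le_trans le \<open>x < l\<close>)
  qed (rule less)
  with l0 show ?thesis
    by (auto simp: a_def)
qed

text \<open>The factor \<open>B\<close> is lost under the \<open>n\<close>-th root: a number
  strictly between \<open>q\<close> and \<open>l\<close> would eventually lie both above and below
  the roots.\<close>

lemma root_norm_power_limit_le:
  assumes "(\<lambda>j. root j (norm (cblinfun_power T j))) \<longlonglongrightarrow> l"
    and "\<And>n. norm (cblinfun_power T n) \<le> B * q ^ n" and "0 \<le> q"
  shows "l \<le> q"
proof (rule ccontr)
  assume "\<not> l \<le> q"
  then obtain q' where q': "q < q'" "q' < l"
    using dense[of q l] by auto
  have "\<forall>\<^sub>F j in sequentially. root j (norm (cblinfun_power T j)) < q'"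
    by (rule eventually_root_less[OF assms(2) _ assms(3) q'(1)]) simp
  moreover have "\<forall>\<^sub>F j in sequentially. q' < root j (norm (cblinfun_power T j))"
    by (rule order_tendstoD(1)[OF assms(1) q'(2)])
  ultimately have "\<forall>\<^sub>F j::nat in sequentially. False"
    by eventually_elim simp
  then show False
    by simp
qed

lemma summable_of_root_limit:
  fixes f :: "nat \<Rightarrow> 'a::banach"
  assumes "(\<lambda>n. root n (norm (f n))) \<longlonglongrightarrow> l" and "l < 1"
  shows "summable f"
proof (rule root_test_convergence')
  have "(\<lambda>n. ereal (root n (norm (f n)))) \<longlonglongrightarrow> ereal l"
    using assms(1) by simp
  then have "limsup (\<lambda>n. ereal (root n (norm (f n)))) = ereal l"
    by (rule lim_imp_Limsup[OF sequentially_bot])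
  then show "limsup (\<lambda>n. ereal (root n (norm (f n)))) < 1"
    using assms(2) by simp
qed

text \<open>Neumann series: composing the sum \<open>S\<close> with \<open>V\<close> on either side
  drops its first term, so both products equal \<open>S - cblinfun_id\<close>.\<close>

lemma invertible_id_minus:
  fixes V :: "'a::complex_banach \<Rightarrow>\<^sub>C\<^sub>L 'a"
  assumes "summable (cblinfun_power V)"
  shows "cblinfun_invertible (cblinfun_id - V)"
proof -
  define S where "S = suminf (cblinfun_power V)"
  have S: "cblinfun_power V sums S"
    unfolding S_def by (rule summable_sums[OF assms])
  have tail: "(\<lambda>n. cblinfun_power V (Suc n)) sums (S - cblinfun_id)"
    using sums_Suc_iff[of "cblinfun_power V" "S - cblinfun_id"] S by simp
  have "(\<lambda>n. V o\<^sub>C cblinfun_power V n) sums (V o\<^sub>C S)"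
    by (rule bounded_linear.sums[OF
          bounded_bilinear.bounded_linear_right[OF bounded_bilinear_cblinfun_compose] S])
  then have "V o\<^sub>C S = S - cblinfun_id"
    using tail by (simp add: sums_unique2)
  moreover have "(\<lambda>n. cblinfun_power V n o\<^sub>C V) sums (S o\<^sub>C V)"
    by (rule bounded_linear.sums[OF
          bounded_bilinear.bounded_linear_left[OF bounded_bilinear_cblinfun_compose] S])
  then have "S o\<^sub>C V = S - cblinfun_id"
    using tail by (simp add: sums_unique2 cblinfun_power_commute)
  ultimately show ?thesis
    unfolding cblinfun_invertible_def cblinfun_is_inverse_def
    by (intro exI[of _ S]) (simp add: cblinfun_compose_simps)
qed

text \<open>The powers of \<open>(- c) *\<^sub>C T\<close> have root limit
  \<open>cmod c * l\<close>, so the Neumann series of this operator converges.\<close>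

lemma invertible_id_plus_scaleC:
  fixes T :: "'a::complex_banach \<Rightarrow>\<^sub>C\<^sub>L 'a"
  assumes l: "(\<lambda>j. root j (norm (cblinfun_power T j))) \<longlonglongrightarrow> l" and "cmod c * l < 1"
  shows "cblinfun_invertible (cblinfun_id + c *\<^sub>C T)"
proof -
  have "(\<lambda>j. cmod c * root j (norm (cblinfun_power T j))) \<longlonglongrightarrow> cmod c * l"
    by (intro tendsto_intros l)
  moreover have "\<forall>\<^sub>F j in sequentially. cmod c * root j (norm (cblinfun_power T j))
      = root j (norm (cblinfun_power ((- c) *\<^sub>C T) j))"
    using eventually_gt_at_top[of "0::nat"]
    by eventually_elim
      (simp add: cblinfun_power_scaleC norm_scaleC norm_power real_root_mult real_root_power_cancel)
  ultimately have "(\<lambda>j. root j (norm (cblinfun_power ((- c) *\<^sub>C T) j))) \<longlonglongrightarrow> cmod c * l"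
    by (rule Lim_transform_eventually)
  from invertible_id_minus[OF summable_of_root_limit[OF this assms(2)]] show ?thesis
    by (simp add: scaleC_minus_left)
qed

text \<open>Iteration puts \<open>n\<close> factors \<open>T\<close> on the left of \<open>W\<close>
  and \<open>n\<close> factors \<open>S\<close> on its right. The product of the norms of these
  powers has root limit \<open>l * l'\<close>, below 1, hence tends to 0.\<close>

lemma eq_sandwich_imp_zero:
  fixes W :: "'a::complex_normed_vector \<Rightarrow>\<^sub>C\<^sub>L 'b::complex_normed_vector"
  assumes W: "W = T o\<^sub>C W o\<^sub>C S"
    and T: "(\<lambda>j. root j (norm (cblinfun_power T j))) \<longlonglongrightarrow> l"
    and S: "(\<lambda>j. root j (norm (cblinfun_power S j))) \<longlonglongrightarrow> l'"
    and "l * l' < 1"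
  shows "W = 0"
proof -
  have pow: "W = cblinfun_power T n o\<^sub>C W o\<^sub>C cblinfun_power S n" for n
  proof (induction n)
    case (Suc n)
    have "W = T o\<^sub>C (cblinfun_power T n o\<^sub>C W o\<^sub>C cblinfun_power S n) o\<^sub>C S"
      using W Suc by simp
    also have "\<dots> = cblinfun_power T (Suc n) o\<^sub>C W o\<^sub>C (cblinfun_power S n o\<^sub>C S)"
      by (simp add: cblinfun_compose_assoc)
    finally show ?case
      by (simp add: cblinfun_power_commute)
  qed simp
  define b where "b n = norm (cblinfun_power T n) * norm (cblinfun_power S n)" for n
  have "(\<lambda>n. root n (norm (b n))) \<longlonglongrightarrow> l * l'"
    using tendsto_mult[OF T S] by (simp add: b_def real_root_mult)
  then have "summable b"
    by (rule summable_of_root_limit) fact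
  then have "b \<longlonglongrightarrow> 0"
    by (rule summable_LIMSEQ_zero)
  then have "(\<lambda>n. b n * norm W) \<longlonglongrightarrow> 0"
    by (simp add: tendsto_mult_left_zero)
  moreover have "norm W \<le> b n * norm W" for n
  proof -
    have "norm W \<le> norm (cblinfun_power T n o\<^sub>C W) * norm (cblinfun_power S n)"
      by (subst pow[of n]) (rule norm_cblinfun_compose)
    also have "\<dots> \<le> (norm (cblinfun_power T n) * norm W) * norm (cblinfun_power S n)"
      by (intro mult_right_mono norm_cblinfun_compose) simp
    finally show ?thesis
      by (simp add: b_def mult_ac)
  qed
  ultimately have "norm W \<le> 0"
    by (intro LIMSEQ_le_const) auto
  then show ?thesis
    by simp
qed

section \<open>Inverses and resolvents\<close>

lemma cblinfun_is_inverse_inv: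
  "cblinfun_invertible T \<Longrightarrow> cblinfun_is_inverse T (cblinfun_inv T)"
  unfolding cblinfun_invertible_def by (auto simp: cblinfun_inv_eqI)

text \<open>Insert \<open>Z o\<^sub>C T\<close> in front of \<open>B o\<^sub>C Z\<close>, move
  \<open>B\<close> past \<open>T\<close>, and cancel \<open>T o\<^sub>C Z\<close>.\<close>

lemma cblinfun_inverse_commute:
  assumes "cblinfun_is_inverse T Z" and "B o\<^sub>C T = T o\<^sub>C B"
  shows "B o\<^sub>C Z = Z o\<^sub>C B"
proof -
  have "B o\<^sub>C Z = (Z o\<^sub>C T) o\<^sub>C B o\<^sub>C Z"
    using assms(1) by (simp add: cblinfun_is_inverse_def)
  also have "\<dots> = Z o\<^sub>C (B o\<^sub>C T) o\<^sub>C Z"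
    by (simp add: assms(2) cblinfun_compose_assoc)
  also have "\<dots> = Z o\<^sub>C B o\<^sub>C (T o\<^sub>C Z)"
    by (simp add: cblinfun_compose_assoc)
  finally show ?thesis
    using assms(1) by (simp add: cblinfun_is_inverse_def)
qed

lemma cblinfun_is_inverse_scaleC:
  assumes "cblinfun_is_inverse T Z" and "c \<noteq> 0"
  shows "cblinfun_is_inverse (c *\<^sub>C T) (inverse c *\<^sub>C Z)"
  using assms by (simp add: cblinfun_is_inverse_def cblinfun_compose_simps scaleC_scaleC)

lemma pencil_resolvent:
  assumes "cblinfun_invertible (pencil A\<^sub>0 A\<^sub>1 z)"
  shows "resolvent A\<^sub>0 A\<^sub>1 z o\<^sub>C A\<^sub>0 + z *\<^sub>C (resolvent A\<^sub>0 A\<^sub>1 z o\<^sub>C A\<^sub>1) = cblinfun_id"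
    and "A\<^sub>0 o\<^sub>C resolvent A\<^sub>0 A\<^sub>1 z + z *\<^sub>C (A\<^sub>1 o\<^sub>C resolvent A\<^sub>0 A\<^sub>1 z) = cblinfun_id"
  using cblinfun_is_inverse_inv[OF assms]
  by (auto simp: cblinfun_is_inverse_def resolvent_def pencil_def cblinfun_compose_simps)

text \<open>The factor \<open>\<lambda>\<^sup>-\<^sup>1 R(-\<lambda>\<^sup>-\<^sup>1)\<close> is the inverse of \<open>\<lambda> A\<^sub>0 - A\<^sub>1\<close>, so that the classical proof of
  the resolvent equation applies.\<close>

lemma reciprocal_resolvent_equation:
  fixes A\<^sub>0 A\<^sub>1 :: "'h::complex_normed_vector \<Rightarrow>\<^sub>C\<^sub>L 'k::complex_normed_vector"
  defines "B \<equiv> \<lambda>l. inverse l *\<^sub>C resolvent A\<^sub>0 A\<^sub>1 (- inverse l)"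
  assumes "l \<noteq> 0" "m \<noteq> 0"
    and "cblinfun_invertible (pencil A\<^sub>0 A\<^sub>1 (- inverse l))"
    and "cblinfun_invertible (pencil A\<^sub>0 A\<^sub>1 (- inverse m))"
  shows "B l - B m = (m - l) *\<^sub>C (B l o\<^sub>C A\<^sub>0 o\<^sub>C B m)"
proof -
  have "l *\<^sub>C (B l o\<^sub>C A\<^sub>0) = cblinfun_id + B l o\<^sub>C A\<^sub>1"
    using pencil_resolvent(1)[OF assms(4)] \<open>l \<noteq> 0\<close>
    by (simp add: B_def cblinfun_compose_simps scaleC_scaleC scaleC_minus_left diff_eq_eq)
  then have l: "l *\<^sub>C (B l o\<^sub>C A\<^sub>0 o\<^sub>C B m) = B m + B l o\<^sub>C A\<^sub>1 o\<^sub>C B m"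
    by (metis cblinfun_compose_scaleC(1) cblinfun_compose_id(2) cblinfun_compose_simps(1))
  have "m *\<^sub>C (A\<^sub>0 o\<^sub>C B m) = cblinfun_id + A\<^sub>1 o\<^sub>C B m"
    using pencil_resolvent(2)[OF assms(5)] \<open>m \<noteq> 0\<close>
    by (simp add: B_def cblinfun_compose_simps scaleC_scaleC scaleC_minus_left diff_eq_eq)
  then have "m *\<^sub>C (B l o\<^sub>C A\<^sub>0 o\<^sub>C B m) = B l + B l o\<^sub>C A\<^sub>1 o\<^sub>C B m"
    by (metis cblinfun_compose_scaleC(2) cblinfun_compose_id(1) cblinfun_compose_simps(2)
        cblinfun_compose_assoc)
  with l show ?thesis
    by (simp add: scaleC_diff_left)
qed

text \<open>Insert the pencil at \<open>z\<close> before \<open>X\<close> and the pencil at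
  \<open>w\<close> after \<open>Y\<close>; the two pencils differ by a multiple of
  \<open>A\<^sub>1\<close>. Continuity and differentiability of the resolvent both rest on this
  identity.\<close>

lemma resolvent_diff:
  assumes "cblinfun_is_inverse (pencil A\<^sub>0 A\<^sub>1 z) X" and "cblinfun_is_inverse (pencil A\<^sub>0 A\<^sub>1 w) Y"
  shows "Y - X = (z - w) *\<^sub>C (Y o\<^sub>C A\<^sub>1 o\<^sub>C X)"
proof -
  have "Y - X = Y o\<^sub>C (pencil A\<^sub>0 A\<^sub>1 z o\<^sub>C X) - (Y o\<^sub>C pencil A\<^sub>0 A\<^sub>1 w) o\<^sub>C X"
    using assms by (simp add: cblinfun_is_inverse_def)
  then show ?thesis
    by (simp add: pencil_def cblinfun_compose_simps cblinfun_compose_assoc scaleC_diff_left)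
qed

text \<open>The difference identity bounds \<open>R w - R z\<close> by
  \<open>dist w z * norm (R w) * K\<close>, which still contains the unknown
  \<open>norm (R w)\<close>. Once \<open>dist w z * K\<close> is below 1/2, that term is absorbed
  and \<open>norm (R w)\<close> is at most \<open>2 * norm (R z)\<close>.\<close>

lemma resolvent_isCont:
  assumes "open U" and inv: "\<And>z. z \<in> U \<Longrightarrow> cblinfun_is_inverse (pencil A\<^sub>0 A\<^sub>1 z) (R z)"
    and z: "z \<in> U"
  shows "isCont R z"
proof -
  define K where "K = norm A\<^sub>1 * norm (R z)"
  have K: "K \<ge> 0"
    by (simp add: K_def)
  have le: "norm (R w - R z) \<le> dist w z * norm (R w) * K" if "w \<in> U" for w
  proof -
    have "norm (R w o\<^sub>C A\<^sub>1 o\<^sub>C R z) \<le> (norm (R w) * norm A\<^sub>1) * norm (R z)"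
      by (intro order_trans[OF norm_cblinfun_compose] mult_right_mono norm_cblinfun_compose) simp
    moreover have "norm (R w - R z) = dist w z * norm (R w o\<^sub>C A\<^sub>1 o\<^sub>C R z)"
      using resolvent_diff[OF inv[OF z] inv[OF that]]
      by (simp add: norm_scaleC dist_norm norm_minus_commute)
    ultimately show ?thesis
      by (simp add: K_def mult.assoc mult_left_mono)
  qed
  have "((\<lambda>w. dist w z * K) \<longlongrightarrow> dist z z * K) (at z)"
    by (intro tendsto_intros)
  then have "\<forall>\<^sub>F w in at z. dist w z * K < 1 / 2"
    by (rule order_tendstoD) simp
  moreover have "\<forall>\<^sub>F w in at z. w \<in> U"
    using \<open>open U\<close> z by (simp add: eventually_at_in_open')
  ultimately have "\<forall>\<^sub>F w in at z. norm (R w - R z) \<le> dist w z * (2 * norm (R z) * K)"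
  proof eventually_elim
    case (elim w)
    have "norm (R w) \<le> norm (R z) + norm (R w - R z)"
      by (simp add: norm_triangle_sub)
    also have "norm (R w - R z) \<le> (dist w z * K) * norm (R w)"
      using le[OF elim(2)] by (simp add: mult_ac)
    also have "\<dots> \<le> 1 / 2 * norm (R w)"
      using elim(1) by (intro mult_right_mono) auto
    finally have "norm (R w) \<le> 2 * norm (R z)"
      by simp
    then have "dist w z * norm (R w) * K \<le> dist w z * (2 * norm (R z)) * K"
      using K by (intro mult_right_mono mult_left_mono) auto
    with le[OF elim(2)] show ?case
      by (simp add: mult_ac)
  qed
  moreover have "((\<lambda>w. dist w z * (2 * norm (R z) * K)) \<longlongrightarrow> dist z z * (2 * norm (R z) * K)) (at z)"
    by (intro tendsto_intros)
  ultimately have "((\<lambda>w. R w - R z) \<longlongrightarrow> 0) (at z)"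
    by (intro Lim_null_comparison[of "\<lambda>w. R w - R z" "\<lambda>w. dist w z * (2 * norm (R z) * K)"]) auto
  then show ?thesis
    by (simp add: isCont_def LIM_zero_iff)
qed

text \<open>By the difference identity, the remainder of the first-order expansion divided by
  \<open>norm (w - z)\<close> has exactly the norm of
  \<open>R w A\<^sub>1 R z - R z A\<^sub>1 R z\<close>, which tends to 0 by continuity.\<close>

lemma resolvent_has_derivative:
  assumes "open U" and inv: "\<And>z. z \<in> U \<Longrightarrow> cblinfun_is_inverse (pencil A\<^sub>0 A\<^sub>1 z) (R z)"
    and z: "z \<in> U"
  shows "(R has_derivative (\<lambda>h. h *\<^sub>C (- (R z o\<^sub>C A\<^sub>1 o\<^sub>C R z)))) (at z)"
proof -
  let ?D = "- (R z o\<^sub>C A\<^sub>1 o\<^sub>C R z)"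
  have "(R \<longlongrightarrow> R z) (at z)"
    using resolvent_isCont[OF assms] by (simp add: isCont_def)
  then have "((\<lambda>w. R w o\<^sub>C A\<^sub>1 o\<^sub>C R z) \<longlongrightarrow> R z o\<^sub>C A\<^sub>1 o\<^sub>C R z) (at z)"
    by (intro bounded_bilinear.tendsto[OF bounded_bilinear_cblinfun_compose] tendsto_const)
  then have lim: "((\<lambda>w. norm (R w o\<^sub>C A\<^sub>1 o\<^sub>C R z - R z o\<^sub>C A\<^sub>1 o\<^sub>C R z)) \<longlongrightarrow> 0) (at z)"
    by (simp add: LIM_zero tendsto_norm_zero)
  have "norm ((1 / norm (w - z)) *\<^sub>R (R w - (R z + (w - z) *\<^sub>C ?D)))
      = norm (R w o\<^sub>C A\<^sub>1 o\<^sub>C R z - R z o\<^sub>C A\<^sub>1 o\<^sub>C R z)" if "w \<in> U" "w \<noteq> z" for w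
  proof -
    have "R w - (R z + (w - z) *\<^sub>C ?D) = (z - w) *\<^sub>C (R w o\<^sub>C A\<^sub>1 o\<^sub>C R z - R z o\<^sub>C A\<^sub>1 o\<^sub>C R z)"
      using resolvent_diff[OF inv[OF z] inv[OF that(1)]]
      by (simp add: scaleC_ring_simps algebra_simps)
    with that show ?thesis
      by (simp add: norm_scaleC norm_minus_commute)
  qed
  moreover have "\<forall>\<^sub>F w in at z. w \<in> U \<and> w \<noteq> z"
    using \<open>open U\<close> z by (simp add: eventually_conj_iff eventually_at_in_open' eventually_neq_at_within)
  ultimately have "\<forall>\<^sub>F w in at z. norm (R w o\<^sub>C A\<^sub>1 o\<^sub>C R z - R z o\<^sub>C A\<^sub>1 o\<^sub>C R z)
      = norm ((1 / norm (w - z)) *\<^sub>R (R w - (R z + (w - z) *\<^sub>C ?D)))"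
    by (auto elim: eventually_mono)
  from Lim_transform_eventually[OF lim this]
  have "((\<lambda>w. (1 / norm (w - z)) *\<^sub>R (R w - (R z + (w - z) *\<^sub>C ?D))) \<longlongrightarrow> 0) (at z)"
    by (rule tendsto_norm_zero_cancel)
  then show ?thesis
    by (simp add: has_derivative_within
        bounded_bilinear.bounded_linear_left[OF bounded_bilinear_scaleC])
qed

section \<open>Algebraic consequences of (i) and (ii)\<close>

text \<open>Conditions (i) and (ii) alone, so that their algebra is separated from the growth
  condition (iii).\<close>

locale basic_pair =
  fixes A\<^sub>0 A\<^sub>1 :: "'h::complex_normed_vector \<Rightarrow>\<^sub>C\<^sub>L 'k::complex_normed_vector"
    and Rm R\<^sub>0 :: "'k \<Rightarrow>\<^sub>C\<^sub>L 'h"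
  assumes sum_h: "Rm o\<^sub>C A\<^sub>1 + R\<^sub>0 o\<^sub>C A\<^sub>0 = cblinfun_id"
    and sum_k: "A\<^sub>1 o\<^sub>C Rm + A\<^sub>0 o\<^sub>C R\<^sub>0 = cblinfun_id"
    and annihilate: "A \<in> {A\<^sub>0, A\<^sub>1} \<Longrightarrow> Rm o\<^sub>C A o\<^sub>C R\<^sub>0 = 0 \<and> R\<^sub>0 o\<^sub>C A o\<^sub>C Rm = 0"
begin

lemma sum_h_apply: "Rm (A\<^sub>1 x) + R\<^sub>0 (A\<^sub>0 x) = x"
  using arg_cong[OF sum_h, of "\<lambda>f. cblinfun_apply f x"] by (simp add: cblinfun_apply_simps)

lemma sum_k_apply: "A\<^sub>1 (Rm y) + A\<^sub>0 (R\<^sub>0 y) = y"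
  using arg_cong[OF sum_k, of "\<lambda>f. cblinfun_apply f y"] by (simp add: cblinfun_apply_simps)

lemma annihilate_apply:
  "Rm (A\<^sub>0 (R\<^sub>0 y)) = 0" "Rm (A\<^sub>1 (R\<^sub>0 y)) = 0" "R\<^sub>0 (A\<^sub>0 (Rm y)) = 0" "R\<^sub>0 (A\<^sub>1 (Rm y)) = 0"
  using arg_cong[OF conjunct1[OF annihilate], of A\<^sub>0 "\<lambda>f. cblinfun_apply f y"]
    arg_cong[OF conjunct1[OF annihilate], of A\<^sub>1 "\<lambda>f. cblinfun_apply f y"]
    arg_cong[OF conjunct2[OF annihilate], of A\<^sub>0 "\<lambda>f. cblinfun_apply f y"]
    arg_cong[OF conjunct2[OF annihilate], of A\<^sub>1 "\<lambda>f. cblinfun_apply f y"]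
  by (simp_all add: cblinfun_apply_simps)

text \<open>Apply (i) to a vector in the range of \<open>Rm\<close> or \<open>R\<^sub>0\<close>: one
  of the two summands vanishes by (ii). In particular \<open>Rm o\<^sub>C A\<^sub>1\<close> and
  \<open>R\<^sub>0 o\<^sub>C A\<^sub>0\<close> are complementary projections.\<close>

lemma reproduce: "Rm (A\<^sub>1 (Rm y)) = Rm y" "R\<^sub>0 (A\<^sub>0 (R\<^sub>0 y)) = R\<^sub>0 y"
  using sum_h_apply[of "Rm y"] sum_h_apply[of "R\<^sub>0 y"] by (simp_all add: annihilate_apply)

text \<open>Expanding \<open>A\<^sub>0 x\<close> with the identity on either space gives two sums
  that share \<open>A\<^sub>0 (R\<^sub>0 (A\<^sub>0 x))\<close>; cancel it. The two expansions of
  \<open>A\<^sub>1 x\<close> share \<open>A\<^sub>1 (Rm (A\<^sub>1 x))\<close>.\<close>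

lemma exchange:
  "A\<^sub>0 (Rm (A\<^sub>1 x)) = A\<^sub>1 (Rm (A\<^sub>0 x))" "A\<^sub>1 (R\<^sub>0 (A\<^sub>0 x)) = A\<^sub>0 (R\<^sub>0 (A\<^sub>1 x))"
proof -
  have "A\<^sub>0 (Rm (A\<^sub>1 x)) + A\<^sub>0 (R\<^sub>0 (A\<^sub>0 x)) = A\<^sub>1 (Rm (A\<^sub>0 x)) + A\<^sub>0 (R\<^sub>0 (A\<^sub>0 x))"
    using arg_cong[OF sum_h_apply[of x], of A\<^sub>0] sum_k_apply[of "A\<^sub>0 x"]
    by (simp add: cblinfun_linear_simps)
  then show "A\<^sub>0 (Rm (A\<^sub>1 x)) = A\<^sub>1 (Rm (A\<^sub>0 x))"
    by simp
  have "A\<^sub>1 (Rm (A\<^sub>1 x)) + A\<^sub>1 (R\<^sub>0 (A\<^sub>0 x)) = A\<^sub>1 (Rm (A\<^sub>1 x)) + A\<^sub>0 (R\<^sub>0 (A\<^sub>1 x))"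
    using arg_cong[OF sum_h_apply[of x], of A\<^sub>1] sum_k_apply[of "A\<^sub>1 x"]
    by (simp add: cblinfun_linear_simps)
  then show "A\<^sub>1 (R\<^sub>0 (A\<^sub>0 x)) = A\<^sub>0 (R\<^sub>0 (A\<^sub>1 x))"
    by simp
qed

text \<open>The projection \<open>Rm o\<^sub>C A\<^sub>1\<close> commutes with \<open>Z\<close> and
  \<open>Y\<close>, so its range and its kernel can be treated separately. Composed with the pencil
  on either side, the two summands of the candidate inverse give the two projections that add up to
  the identity by (i).\<close>

lemma resolvent_decomposition:
  assumes Z: "cblinfun_is_inverse (z *\<^sub>C cblinfun_id + Rm o\<^sub>C A\<^sub>0) Z"
    and Y: "cblinfun_is_inverse (cblinfun_id + z *\<^sub>C (R\<^sub>0 o\<^sub>C A\<^sub>1)) Y"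
  shows "cblinfun_is_inverse (pencil A\<^sub>0 A\<^sub>1 z) (Z o\<^sub>C Rm + Y o\<^sub>C R\<^sub>0)"
    and "(Rm o\<^sub>C A\<^sub>1) o\<^sub>C (Z o\<^sub>C Rm + Y o\<^sub>C R\<^sub>0) o\<^sub>C (A\<^sub>1 o\<^sub>C Rm) = Z o\<^sub>C Rm"
    and "(cblinfun_id - Rm o\<^sub>C A\<^sub>1) o\<^sub>C (Z o\<^sub>C Rm + Y o\<^sub>C R\<^sub>0) o\<^sub>C (cblinfun_id - A\<^sub>1 o\<^sub>C Rm) = Y o\<^sub>C R\<^sub>0"
proof -
  have "(Rm o\<^sub>C A\<^sub>1) o\<^sub>C (z *\<^sub>C cblinfun_id + Rm o\<^sub>C A\<^sub>0) = (z *\<^sub>C cblinfun_id + Rm o\<^sub>C A\<^sub>0) o\<^sub>C (Rm o\<^sub>C A\<^sub>1)"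
    by (rule cblinfun_eqI)
      (simp add: cblinfun_apply_simps cblinfun_linear_simps reproduce exchange)
  from cblinfun_inverse_commute[OF Z this] have PZ: "Rm (A\<^sub>1 (Z x)) = Z (Rm (A\<^sub>1 x))" for x
    by (metis cblinfun_compose.rep_eq)
  have "(Rm o\<^sub>C A\<^sub>1) o\<^sub>C (cblinfun_id + z *\<^sub>C (R\<^sub>0 o\<^sub>C A\<^sub>1)) = (cblinfun_id + z *\<^sub>C (R\<^sub>0 o\<^sub>C A\<^sub>1)) o\<^sub>C (Rm o\<^sub>C A\<^sub>1)"
    by (rule cblinfun_eqI)
      (simp add: cblinfun_apply_simps cblinfun_linear_simps annihilate_apply)
  from cblinfun_inverse_commute[OF Y this] have PY: "Rm (A\<^sub>1 (Y x)) = Y (Rm (A\<^sub>1 x))" for x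
    by (metis cblinfun_compose.rep_eq)
  have ZT: "Z (z *\<^sub>C x + Rm (A\<^sub>0 x)) = x" and TZ: "z *\<^sub>C Z x + Rm (A\<^sub>0 (Z x)) = x" for x
    using Z[unfolded cblinfun_is_inverse_def, THEN conjunct1, THEN arg_cong, of "\<lambda>f. f x"]
      Z[unfolded cblinfun_is_inverse_def, THEN conjunct2, THEN arg_cong, of "\<lambda>f. f x"]
    by (simp_all add: cblinfun_apply_simps)
  have YS: "Y (x + z *\<^sub>C R\<^sub>0 (A\<^sub>1 x)) = x" and SY: "Y x + z *\<^sub>C R\<^sub>0 (A\<^sub>1 (Y x)) = x" for x
    using Y[unfolded cblinfun_is_inverse_def, THEN conjunct1, THEN arg_cong, of "\<lambda>f. f x"]
      Y[unfolded cblinfun_is_inverse_def, THEN conjunct2, THEN arg_cong, of "\<lambda>f. f x"]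
    by (simp_all add: cblinfun_apply_simps)
  \<comment> \<open>By \<open>exchange\<close> and \<open>reproduce\<close>,
    \<open>Rm (A\<^sub>0 x)\<close> is unchanged when \<open>x\<close> is replaced by its projection
    \<open>Rm (A\<^sub>1 x)\<close>, so the left inverse law can be used at the projection.\<close>
  have "Z (Rm (A\<^sub>0 x + z *\<^sub>C A\<^sub>1 x)) = Rm (A\<^sub>1 x)" for x
    using ZT[of "Rm (A\<^sub>1 x)"] by (simp add: cblinfun_linear_simps exchange reproduce add.commute)
  moreover have "Y (R\<^sub>0 (A\<^sub>0 x + z *\<^sub>C A\<^sub>1 x)) = R\<^sub>0 (A\<^sub>0 x)" for x
    using YS[of "R\<^sub>0 (A\<^sub>0 x)"] by (simp add: cblinfun_linear_simps exchange reproduce)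
  ultimately have left: "(Z o\<^sub>C Rm + Y o\<^sub>C R\<^sub>0) o\<^sub>C pencil A\<^sub>0 A\<^sub>1 z = cblinfun_id"
    by (intro cblinfun_eqI) (simp add: cblinfun_apply_simps pencil_def sum_h_apply)
  \<comment> \<open>The projection \<open>Rm o\<^sub>C A\<^sub>1\<close> fixes
    \<open>Z (Rm y)\<close>, so \<open>R\<^sub>0 o\<^sub>C A\<^sub>0\<close> annihilates it and
    \<open>A\<^sub>1 o\<^sub>C Rm\<close> fixes its image under \<open>A\<^sub>0\<close>.\<close>
  have "A\<^sub>0 (Z (Rm y)) = A\<^sub>1 (Rm (A\<^sub>0 (Z (Rm y))))" for y
    using sum_h_apply[of "Z (Rm y)"] sum_k_apply[of "A\<^sub>0 (Z (Rm y))"]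
    by (simp add: PZ reproduce cblinfun_linear_simps)
  then have "A\<^sub>0 (Z (Rm y)) + z *\<^sub>C A\<^sub>1 (Z (Rm y)) = A\<^sub>1 (Rm y)" for y
    using arg_cong[OF TZ[of "Rm y"], of A\<^sub>1] by (simp add: cblinfun_linear_simps add.commute)
  \<comment> \<open>Here the projection \<open>Rm o\<^sub>C A\<^sub>1\<close> annihilates
    \<open>Y (R\<^sub>0 y)\<close>, which leaves only the other summand of (i) on the
    codomain.\<close>
  moreover have "A\<^sub>1 (Y (R\<^sub>0 y)) = A\<^sub>0 (R\<^sub>0 (A\<^sub>1 (Y (R\<^sub>0 y))))" for y
    using sum_k_apply[of "A\<^sub>1 (Y (R\<^sub>0 y))"]
    by (simp add: PY annihilate_apply cblinfun_linear_simps)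
  then have "A\<^sub>0 (Y (R\<^sub>0 y)) + z *\<^sub>C A\<^sub>1 (Y (R\<^sub>0 y)) = A\<^sub>0 (R\<^sub>0 y)" for y
    using arg_cong[OF SY[of "R\<^sub>0 y"], of A\<^sub>0] by (simp add: cblinfun_linear_simps)
  ultimately have "pencil A\<^sub>0 A\<^sub>1 z (Z (Rm y) + Y (R\<^sub>0 y)) = y" for y
    using sum_k_apply[of y]
    by (simp add: cblinfun_apply_simps pencil_def cblinfun_linear_simps scaleC_ring_simps)
      (metis (no_types, lifting) add.assoc add.left_commute)
  then have "pencil A\<^sub>0 A\<^sub>1 z o\<^sub>C (Z o\<^sub>C Rm + Y o\<^sub>C R\<^sub>0) = cblinfun_id"
    by (intro cblinfun_eqI) (simp add: cblinfun_apply_simps)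
  with left show "cblinfun_is_inverse (pencil A\<^sub>0 A\<^sub>1 z) (Z o\<^sub>C Rm + Y o\<^sub>C R\<^sub>0)"
    by (simp add: cblinfun_is_inverse_def)
  show "(Rm o\<^sub>C A\<^sub>1) o\<^sub>C (Z o\<^sub>C Rm + Y o\<^sub>C R\<^sub>0) o\<^sub>C (A\<^sub>1 o\<^sub>C Rm) = Z o\<^sub>C Rm"
    and "(cblinfun_id - Rm o\<^sub>C A\<^sub>1) o\<^sub>C (Z o\<^sub>C Rm + Y o\<^sub>C R\<^sub>0) o\<^sub>C (cblinfun_id - A\<^sub>1 o\<^sub>C Rm) = Y o\<^sub>C R\<^sub>0"
    by (auto intro!: cblinfun_eqI simp: cblinfun_apply_simps cblinfun_linear_simps PZ PY
        reproduce annihilate_apply)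
qed

end

text \<open>With \<open>P = Rm A\<^sub>1\<close> and \<open>P' = Rm' A\<^sub>1\<close>, both \<open>P' (I - P)\<close> and \<open>(I - P') P\<close> are reproduced when
  multiplied by an operator of spectral radius at most \<open>s\<close> on one side and by one of spectral
  radius at most \<open>1/r\<close> on the other; hence they vanish.\<close>

lemma basic_pair_cross_zero:
  assumes "basic_pair A\<^sub>0 A\<^sub>1 Rm R\<^sub>0" and "basic_pair A\<^sub>0 A\<^sub>1 Rm' R\<^sub>0'"
    and "(\<lambda>j. root j (norm (cblinfun_power (Rm o\<^sub>C A\<^sub>0) j))) \<longlonglongrightarrow> a"
    and "(\<lambda>j. root j (norm (cblinfun_power (R\<^sub>0 o\<^sub>C A\<^sub>1) j))) \<longlonglongrightarrow> b"
    and "(\<lambda>j. root j (norm (cblinfun_power (Rm' o\<^sub>C A\<^sub>0) j))) \<longlonglongrightarrow> a'"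
    and "(\<lambda>j. root j (norm (cblinfun_power (R\<^sub>0' o\<^sub>C A\<^sub>1) j))) \<longlonglongrightarrow> b'"
    and "a' * b < 1" and "b' * a < 1"
  shows "Rm' (A\<^sub>1 (R\<^sub>0 y)) = 0" and "R\<^sub>0' (A\<^sub>0 (Rm y)) = 0"
proof -
  interpret p: basic_pair A\<^sub>0 A\<^sub>1 Rm R\<^sub>0
    by fact
  interpret p': basic_pair A\<^sub>0 A\<^sub>1 Rm' R\<^sub>0'
    by fact
  \<comment> \<open>At \<open>x\<close> both sides reduce to
    \<open>Rm' (A\<^sub>0 (R\<^sub>0 (A\<^sub>1 x)))\<close>:
    \<open>R\<^sub>0 A\<^sub>0 R\<^sub>0\<close> is contracted first, then \<open>exchange\<close>
    moves \<open>A\<^sub>0\<close> and \<open>A\<^sub>1\<close> across \<open>Rm'\<close> and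
    \<open>R\<^sub>0\<close>.\<close>
  have "Rm' o\<^sub>C A\<^sub>1 o\<^sub>C R\<^sub>0 o\<^sub>C A\<^sub>0 = (Rm' o\<^sub>C A\<^sub>0) o\<^sub>C (Rm' o\<^sub>C A\<^sub>1 o\<^sub>C R\<^sub>0 o\<^sub>C A\<^sub>0) o\<^sub>C (R\<^sub>0 o\<^sub>C A\<^sub>1)"
    by (rule cblinfun_eqI)
      (simp only: cblinfun_apply_simps p.reproduce, simp only: p'.exchange(1) p.exchange(2) p'.reproduce)
  from eq_sandwich_imp_zero[OF this assms(5,4,7)] have "Rm' (A\<^sub>1 (R\<^sub>0 (A\<^sub>0 x))) = 0" for x
    by (metis cblinfun_compose.rep_eq zero_cblinfun.rep_eq)
  from this[of "R\<^sub>0 y"] show "Rm' (A\<^sub>1 (R\<^sub>0 y)) = 0"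
    by (simp add: p.reproduce)
  have "R\<^sub>0' o\<^sub>C A\<^sub>0 o\<^sub>C Rm o\<^sub>C A\<^sub>1 = (R\<^sub>0' o\<^sub>C A\<^sub>1) o\<^sub>C (R\<^sub>0' o\<^sub>C A\<^sub>0 o\<^sub>C Rm o\<^sub>C A\<^sub>1) o\<^sub>C (Rm o\<^sub>C A\<^sub>0)"
    by (rule cblinfun_eqI)
      (simp only: cblinfun_apply_simps p.reproduce, simp only: p'.exchange(2) p.exchange(1) p'.reproduce)
  from eq_sandwich_imp_zero[OF this assms(6,3,8)] have "R\<^sub>0' (A\<^sub>0 (Rm (A\<^sub>1 x))) = 0" for x
    by (metis cblinfun_compose.rep_eq zero_cblinfun.rep_eq)
  from this[of "Rm y"] show "R\<^sub>0' (A\<^sub>0 (Rm y)) = 0"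
    by (simp add: p.reproduce)
qed

text \<open>Once the mixed products vanish, inserting the identities (i) of the two pairs shows that
  \<open>Rm\<close> and \<open>Rm'\<close> both equal \<open>Rm A\<^sub>1 Rm'\<close>, and that
  \<open>R\<^sub>0\<close> and \<open>R\<^sub>0'\<close> both equal
  \<open>R\<^sub>0 A\<^sub>0 R\<^sub>0'\<close>.\<close>

lemma basic_pair_unique:
  assumes "basic_pair A\<^sub>0 A\<^sub>1 Rm R\<^sub>0" and "basic_pair A\<^sub>0 A\<^sub>1 Rm' R\<^sub>0'"
    and "(\<lambda>j. root j (norm (cblinfun_power (Rm o\<^sub>C A\<^sub>0) j))) \<longlonglongrightarrow> a"
    and "(\<lambda>j. root j (norm (cblinfun_power (R\<^sub>0 o\<^sub>C A\<^sub>1) j))) \<longlonglongrightarrow> b"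
    and "(\<lambda>j. root j (norm (cblinfun_power (Rm' o\<^sub>C A\<^sub>0) j))) \<longlonglongrightarrow> a'"
    and "(\<lambda>j. root j (norm (cblinfun_power (R\<^sub>0' o\<^sub>C A\<^sub>1) j))) \<longlonglongrightarrow> b'"
    and "a' * b < 1" and "a * b' < 1"
  shows "Rm' = Rm" and "R\<^sub>0' = R\<^sub>0"
proof -
  interpret p: basic_pair A\<^sub>0 A\<^sub>1 Rm R\<^sub>0
    by fact
  interpret p': basic_pair A\<^sub>0 A\<^sub>1 Rm' R\<^sub>0'
    by fact
  have 1: "Rm (A\<^sub>1 (R\<^sub>0' y)) = 0" "R\<^sub>0 (A\<^sub>0 (Rm' y)) = 0" for y
    using basic_pair_cross_zero[OF assms(2,1) assms(5,6,3,4)] assms(7,8)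
    by (simp_all add: mult.commute)
  have "Rm (A\<^sub>0 (R\<^sub>0' y)) = Rm (A\<^sub>0 (Rm (A\<^sub>1 (R\<^sub>0' y))))" for y
    by (simp only: p.exchange p.reproduce)
  then have 2: "Rm (A\<^sub>0 (R\<^sub>0' y)) = 0" for y
    by (simp add: 1 cblinfun_linear_simps)
  have "Rm' y = Rm y" for y
    using p.sum_h_apply[of "Rm' y"] arg_cong[OF p'.sum_k_apply[of y], of Rm]
    by (simp add: cblinfun_linear_simps 1 2)
  then show Rm: "Rm' = Rm"
    by (rule cblinfun_eqI)
  have "R\<^sub>0' y = R\<^sub>0 y" for y
    using p.sum_h_apply[of "R\<^sub>0' y"] arg_cong[OF p'.sum_k_apply[of y], of R\<^sub>0]
    by (simp add: cblinfun_linear_simps 1 Rm p.annihilate_apply)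
  then show "R\<^sub>0' = R\<^sub>0"
    by (rule cblinfun_eqI)
qed

section \<open>Uniqueness of basic solutions and the resolvent they determine\<close>

lemma basic_solution_pairD: "basic_solution A\<^sub>0 A\<^sub>1 s r Rm R\<^sub>0 \<Longrightarrow> basic_pair A\<^sub>0 A\<^sub>1 Rm R\<^sub>0"
  unfolding basic_solution_def by unfold_locales blast+

lemma root_norm_limit_nonneg:
  fixes a :: "nat \<Rightarrow> 'a::real_normed_vector"
  assumes "(\<lambda>j. root j (norm (a j))) \<longlonglongrightarrow> l"
  shows "0 \<le> l"
  by (rule LIMSEQ_le_const[OF assms]) (simp add: real_root_ge_zero)

text \<open>By (iii), each mixed product of root limits is at most \<open>s / r\<close>, which is
  below 1.\<close>

lemma basic_solution_unique:
  assumes s: "0 \<le> s" "s < r"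
    and "basic_solution A\<^sub>0 A\<^sub>1 s r Rm R\<^sub>0" "basic_solution A\<^sub>0 A\<^sub>1 s r Rm' R\<^sub>0'"
  shows "Rm' = Rm \<and> R\<^sub>0' = R\<^sub>0"
proof -
  obtain a b a' b' where l: "(\<lambda>j. root j (norm (cblinfun_power (Rm o\<^sub>C A\<^sub>0) j))) \<longlonglongrightarrow> a"
    "(\<lambda>j. root j (norm (cblinfun_power (R\<^sub>0 o\<^sub>C A\<^sub>1) j))) \<longlonglongrightarrow> b"
    "(\<lambda>j. root j (norm (cblinfun_power (Rm' o\<^sub>C A\<^sub>0) j))) \<longlonglongrightarrow> a'"
    "(\<lambda>j. root j (norm (cblinfun_power (R\<^sub>0' o\<^sub>C A\<^sub>1) j))) \<longlonglongrightarrow> b'"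
    and le: "a \<le> s" "b \<le> 1 / r" "a' \<le> s" "b' \<le> 1 / r"
    using assms(3,4) unfolding basic_solution_def by blast
  have less: "x * y < 1" if "x \<le> s" "y \<le> 1 / r" "0 \<le> y" for x y
  proof -
    have "x * y \<le> s * (1 / r)"
      using that s by (intro mult_mono) auto
    also have "\<dots> < 1"
      using s by simp
    finally show ?thesis .
  qed
  have "a' * b < 1" "a * b' < 1"
    using le by (auto intro!: less root_norm_limit_nonneg[OF l(2)] root_norm_limit_nonneg[OF l(4)])
  with basic_pair_unique[OF assms(3,4)[THEN basic_solution_pairD] l] show ?thesis
    by blast
qed

lemma annulus_real_iff: "z \<in> annulus (ereal s) (ereal r) \<longleftrightarrow> s < cmod z \<and> cmod z < r"
  by (simp add: annulus_def)

lemma basic_solution_resolvent: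
  fixes A\<^sub>0 A\<^sub>1 :: "'h::complex_banach \<Rightarrow>\<^sub>C\<^sub>L 'k::complex_banach"
  defines "R \<equiv> resolvent A\<^sub>0 A\<^sub>1"
  assumes s: "0 \<le> s" "s < r" and sol: "basic_solution A\<^sub>0 A\<^sub>1 s r Rm R\<^sub>0"
    and z: "z \<in> annulus (ereal s) (ereal r)"
  shows "cblinfun_invertible (z *\<^sub>C cblinfun_id + Rm o\<^sub>C A\<^sub>0)"
    and "cblinfun_invertible (cblinfun_id + z *\<^sub>C (R\<^sub>0 o\<^sub>C A\<^sub>1))"
    and "cblinfun_invertible (pencil A\<^sub>0 A\<^sub>1 z)"
    and "(Rm o\<^sub>C A\<^sub>1) o\<^sub>C R z o\<^sub>C (A\<^sub>1 o\<^sub>C Rm) = cblinfun_inv (z *\<^sub>C cblinfun_id + Rm o\<^sub>C A\<^sub>0) o\<^sub>C Rm"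
    and "(cblinfun_id - Rm o\<^sub>C A\<^sub>1) o\<^sub>C R z o\<^sub>C (cblinfun_id - A\<^sub>1 o\<^sub>C Rm) =
      cblinfun_inv (cblinfun_id + z *\<^sub>C (R\<^sub>0 o\<^sub>C A\<^sub>1)) o\<^sub>C R\<^sub>0"
    and "R z = cblinfun_inv (z *\<^sub>C cblinfun_id + Rm o\<^sub>C A\<^sub>0) o\<^sub>C Rm +
      cblinfun_inv (cblinfun_id + z *\<^sub>C (R\<^sub>0 o\<^sub>C A\<^sub>1)) o\<^sub>C R\<^sub>0"
proof -
  obtain a b where l: "(\<lambda>j. root j (norm (cblinfun_power (Rm o\<^sub>C A\<^sub>0) j))) \<longlonglongrightarrow> a"
    "(\<lambda>j. root j (norm (cblinfun_power (R\<^sub>0 o\<^sub>C A\<^sub>1) j))) \<longlonglongrightarrow> b"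
    and le: "a \<le> s" "b \<le> 1 / r"
    using sol unfolding basic_solution_def by blast
  have zs: "s < cmod z" "cmod z < r" "z \<noteq> 0"
    using z s by (auto simp: annulus_real_iff)
  have "a < cmod z"
    using le zs by simp
  then have "cmod (inverse z) * a < 1"
    using zs by (simp add: norm_inverse norm_divide field_simps)
  then have "cblinfun_invertible (cblinfun_id + inverse z *\<^sub>C (Rm o\<^sub>C A\<^sub>0))"
    by (rule invertible_id_plus_scaleC[OF l(1)])
  then obtain Z' where "cblinfun_is_inverse (cblinfun_id + inverse z *\<^sub>C (Rm o\<^sub>C A\<^sub>0)) Z'"
    by (auto simp: cblinfun_invertible_def)
  \<comment> \<open>The root limit \<open>a\<close> lies below \<open>cmod z\<close>, which inverts
    \<open>I + (1/z) Rm A\<^sub>0\<close>; multiplication by \<open>z\<close> yields the required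
    operator.\<close>
  from cblinfun_is_inverse_scaleC[OF this \<open>z \<noteq> 0\<close>]
  show invZ: "cblinfun_invertible (z *\<^sub>C cblinfun_id + Rm o\<^sub>C A\<^sub>0)"
    using \<open>z \<noteq> 0\<close> by (auto simp: cblinfun_invertible_def scaleC_add_right scaleC_scaleC)
  have "cmod z * b \<le> cmod z * (1 / r)"
    using le by (intro mult_left_mono) auto
  also have "\<dots> < 1"
    using zs s by simp
  finally show invY: "cblinfun_invertible (cblinfun_id + z *\<^sub>C (R\<^sub>0 o\<^sub>C A\<^sub>1))"
    by (rule invertible_id_plus_scaleC[OF l(2)])
  interpret basic_pair A\<^sub>0 A\<^sub>1 Rm R\<^sub>0
    by (rule basic_solution_pairD[OF sol])
  note dec = resolvent_decomposition[OF cblinfun_is_inverse_inv[OF invZ] cblinfun_is_inverse_inv[OF invY]]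
  show "cblinfun_invertible (pencil A\<^sub>0 A\<^sub>1 z)"
    using dec(1) by (auto simp: cblinfun_invertible_def)
  show Rz: "R z = cblinfun_inv (z *\<^sub>C cblinfun_id + Rm o\<^sub>C A\<^sub>0) o\<^sub>C Rm +
      cblinfun_inv (cblinfun_id + z *\<^sub>C (R\<^sub>0 o\<^sub>C A\<^sub>1)) o\<^sub>C R\<^sub>0"
    unfolding R_def resolvent_def by (rule cblinfun_inv_eqI[OF dec(1)])
  show "(Rm o\<^sub>C A\<^sub>1) o\<^sub>C R z o\<^sub>C (A\<^sub>1 o\<^sub>C Rm) = cblinfun_inv (z *\<^sub>C cblinfun_id + Rm o\<^sub>C A\<^sub>0) o\<^sub>C Rm"
    and "(cblinfun_id - Rm o\<^sub>C A\<^sub>1) o\<^sub>C R z o\<^sub>C (cblinfun_id - A\<^sub>1 o\<^sub>C Rm) =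
      cblinfun_inv (cblinfun_id + z *\<^sub>C (R\<^sub>0 o\<^sub>C A\<^sub>1)) o\<^sub>C R\<^sub>0"
    unfolding Rz by (rule dec(2), rule dec(3))
qed

section \<open>Laurent coefficients\<close>

text \<open>Cauchy's theorem in logarithmic coordinates: the circle of radius \<open>exp u\<close>
  becomes a vertical segment with real part \<open>u\<close>. The \<open>u\<close>-derivative of the
  integral is the integral of \<open>D\<close>, and \<open>\<i> *\<^sub>C D\<close> is the
  \<open>t\<close>-derivative of \<open>h\<close>, so periodicity makes it vanish.\<close>

lemma circle_integral_constant:
  fixes h :: "complex \<Rightarrow> 'a::complex_banach"
  assumes "convex U"
    and der: "\<And>\<zeta>. Re \<zeta> \<in> U \<Longrightarrow> (h has_derivative (\<lambda>k. k *\<^sub>C D \<zeta>)) (at \<zeta>)"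
    and cont: "continuous_on {\<zeta>. Re \<zeta> \<in> U} D"
    and per: "\<And>u. u \<in> U \<Longrightarrow> h (Complex u (2 * pi)) = h (Complex u 0)"
  shows "\<exists>I. \<forall>u\<in>U. integral {0..2 * pi} (\<lambda>t. h (Complex u t)) = I"
proof (rule has_derivative_zero_constant[OF \<open>convex U\<close>])
  fix u assume u: "u \<in> U"
  have cont_h: "continuous_on {\<zeta>. Re \<zeta> \<in> U} h"
    by (rule has_derivative_continuous_on) (auto intro: has_derivative_at_withinI der)
  have der_u: "((\<lambda>x. h (Complex x t)) has_vector_derivative D (Complex x t)) (at x within U)"
    if "x \<in> U" for x t
  proof -
    have "((\<lambda>x. Complex x t) has_derivative of_real) (at x within U)"
      by (auto simp: Complex_eq intro!: derivative_eq_intros)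
    from has_derivative_compose[OF this der] that show ?thesis
      by (simp add: has_vector_derivative_def scaleC_of_real)
  qed
  have der_t: "((\<lambda>t. h (Complex u t)) has_vector_derivative \<i> *\<^sub>C D (Complex u t)) (at t within S)"
    for t S
  proof -
    have "((\<lambda>t. Complex u t) has_derivative (\<lambda>k. of_real k * \<i>)) (at t within S)"
      by (auto simp: Complex_eq intro!: derivative_eq_intros)
    from has_derivative_compose[OF this der] u show ?thesis
      by (simp add: has_vector_derivative_def scaleC_of_real flip: scaleC_scaleC)
  qed
  have "((\<lambda>t. \<i> *\<^sub>C D (Complex u t)) has_integral (h (Complex u (2 * pi)) - h (Complex u 0))) {0..2 * pi}"
    by (rule fundamental_theorem_of_calculus) (auto intro: der_t)
  from has_integral_linear[OF this bounded_linear_scaleC_right[of "- \<i>"]]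
  have zero: "integral {0..2 * pi} (\<lambda>t. D (Complex u t)) = 0"
    using per[OF u] by (simp add: o_def scaleC_scaleC integral_unique)
  have "((\<lambda>u. integral (cbox 0 (2 * pi)) (\<lambda>t. h (Complex u t))) has_vector_derivative
      integral (cbox 0 (2 * pi)) (\<lambda>t. D (Complex u t))) (at u within U)"
  proof (rule leibniz_rule_vector_derivative[OF der_u])
    show "(\<lambda>t. h (Complex x t)) integrable_on cbox 0 (2 * pi)" if "x \<in> U" for x
      by (intro integrable_continuous continuous_on_compose2[OF cont_h])
        (auto simp: Complex_eq that intro!: continuous_intros)
    show "continuous_on (U \<times> cbox 0 (2 * pi)) (\<lambda>(x, t). D (Complex x t))"
      unfolding case_prod_unfold
      by (intro continuous_on_compose2[OF cont]) (auto simp: Complex_eq intro!: continuous_intros)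
  qed (use u \<open>convex U\<close> in auto)
  then show "((\<lambda>u. integral {0..2 * pi} (\<lambda>t. h (Complex u t))) has_derivative (\<lambda>k. 0)) (at u within U)"
    by (simp add: zero has_vector_derivative_def)
qed

lemma exp_of_int_Complex_2pi:
  "exp (of_int n * Complex u (2 * pi)) = exp (of_int n * Complex u 0)"
proof -
  have "of_int n * Complex u (2 * pi) = of_int n * Complex u 0 + 2 * of_int n * of_real pi * \<i>"
    by (simp add: Complex_eq algebra_simps)
  moreover have "exp (2 * of_int n * of_real pi * \<i>) = 1"
    using exp_integer_2pi[of "of_int n"] by simp
  ultimately show ?thesis
    by (simp only: exp_add mult_1_right)
qed

text \<open>The contour integral of \<open>F z / z ^ (n + 1)\<close> divided by
  \<open>2 * pi * \<i>\<close>, over the circle \<open>z = exp (Complex u t)\<close> where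
  \<open>dz = \<i> z dt\<close>. The parameter \<open>u\<close> is the logarithm of the
  radius.\<close>

definition laurent_coeff :: "(complex \<Rightarrow> 'a::complex_banach) \<Rightarrow> int \<Rightarrow> real \<Rightarrow> 'a"
  where "laurent_coeff F n u = (1 / (2 * pi)) *\<^sub>R
    integral {0..2 * pi} (\<lambda>t. exp (of_int (- n) * Complex u t) *\<^sub>C F (exp (Complex u t)))"

lemma cmod_exp_Complex [simp]: "cmod (exp (Complex u t)) = exp u"
  by simp

lemma continuous_on_circle:
  assumes "continuous_on {z. cmod z = exp u} F"
  shows "continuous_on {0..2 * pi} (\<lambda>t. exp (of_int n * Complex u t) *\<^sub>C F (exp (Complex u t)))"
proof -
  have "continuous_on {0..2 * pi} (\<lambda>t. F (exp (Complex u t)))"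
    by (intro continuous_on_compose2[OF assms])
      (auto simp: Complex_eq intro!: continuous_intros)
  then show ?thesis
    by (intro bounded_bilinear.continuous_on[OF bounded_bilinear_scaleC])
      (auto simp: Complex_eq intro!: continuous_intros)
qed

text \<open>Cauchy estimate: \<open>F\<close> is bounded on the compact circle, and that bound
  serves all \<open>n\<close> at once.\<close>

lemma laurent_coeff_bound:
  assumes "continuous_on {z. cmod z = exp u} F"
  shows "\<exists>B. \<forall>n. norm (laurent_coeff F n u) \<le> B * exp u powi (- n)"
proof -
  have "continuous_on {0..2 * pi} (\<lambda>t. F (exp (Complex u t)))"
    using continuous_on_circle[OF assms, of 0] by simp
  then have "bounded ((\<lambda>t. F (exp (Complex u t))) ` {0..2 * pi})"
    by (intro compact_imp_bounded compact_continuous_image) auto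
  then obtain B where "\<forall>x\<in>(\<lambda>t. F (exp (Complex u t))) ` {0..2 * pi}. norm x \<le> B"
    unfolding bounded_iff by blast
  then have B: "norm (F (exp (Complex u t))) \<le> B" if "t \<in> {0..2 * pi}" for t
    using that by blast
  have "norm (laurent_coeff F n u) \<le> B * exp u powi (- n)" for n
  proof -
    have "norm (exp (of_int (- n) * Complex u t) *\<^sub>C F (exp (Complex u t))) \<le> exp u powi (- n) * B"
      if "t \<in> {0..2 * pi}" for t
      using mult_left_mono[OF B[OF that], of "exp u powi (- n)"]
      by (simp add: norm_scaleC exp_power_int)
    then have "norm (integral {0..2 * pi} (\<lambda>t. exp (of_int (- n) * Complex u t) *\<^sub>C F (exp (Complex u t))))
        \<le> (exp u powi (- n) * B) * (2 * pi - 0)"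
      by (intro integral_bound continuous_on_circle assms) auto
    then show ?thesis
      by (simp add: laurent_coeff_def field_simps)
  qed
  then show ?thesis
    by blast
qed

text \<open>Composition with \<open>exp\<close> turns the annulus into a vertical strip, where the
  mean over a segment does not depend on its real part.\<close>

lemma laurent_coeff_constant:
  assumes der: "\<And>z. cmod z \<in> {s<..<r} \<Longrightarrow> (F has_derivative (\<lambda>k. k *\<^sub>C D z)) (at z)"
    and cont: "continuous_on {z. cmod z \<in> {s<..<r}} D"
    and "exp u \<in> {s<..<r}" and "exp v \<in> {s<..<r}"
  shows "laurent_coeff F n u = laurent_coeff F n v"
proof -
  define U where "U = {u. exp u \<in> {s<..<r}}"
  define h where "h \<zeta> = exp (of_int (- n) * \<zeta>) *\<^sub>C F (exp \<zeta>)" for \<zeta>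
  have cont_F: "continuous_on {z. cmod z \<in> {s<..<r}} F"
    by (rule has_derivative_continuous_on[OF has_derivative_at_withinI[OF der]]) simp
  have "\<exists>I. \<forall>u\<in>U. integral {0..2 * pi} (\<lambda>t. h (Complex u t)) = I"
  proof (rule circle_integral_constant)
    have "is_interval U"
      unfolding is_interval_1 U_def
      by (auto intro: less_le_trans le_less_trans)
    then show "convex U"
      by (rule is_interval_convex)
    fix \<zeta> assume "Re \<zeta> \<in> U"
    then have *: "cmod (exp \<zeta>) \<in> {s<..<r}"
      by (simp add: U_def)
    have e: "((\<lambda>\<zeta>. exp \<zeta>) has_derivative (\<lambda>k. k * exp \<zeta>)) (at \<zeta>)"
      by (auto intro!: derivative_eq_intros)
    have "((\<lambda>\<zeta>. F (exp \<zeta>)) has_derivative (\<lambda>k. (k * exp \<zeta>) *\<^sub>C D (exp \<zeta>))) (at \<zeta>)"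
      by (rule has_derivative_compose[OF e der[OF *]])
    moreover have "((\<lambda>\<zeta>. exp (of_int (- n) * \<zeta>)) has_field_derivative
        of_int (- n) * exp (of_int (- n) * \<zeta>)) (at \<zeta>)"
      by (auto intro!: derivative_eq_intros)
    then have "((\<lambda>\<zeta>. exp (of_int (- n) * \<zeta>)) has_derivative
        (\<lambda>k. k * (of_int (- n) * exp (of_int (- n) * \<zeta>)))) (at \<zeta>)"
      by (simp only: has_field_derivative_def mult_commute_abs)
    ultimately have "(h has_derivative (\<lambda>k. exp (of_int (- n) * \<zeta>) *\<^sub>C (k * exp \<zeta>) *\<^sub>C D (exp \<zeta>) +
        (k * (of_int (- n) * exp (of_int (- n) * \<zeta>))) *\<^sub>C F (exp \<zeta>))) (at \<zeta>)"
      unfolding h_def by (rule bounded_bilinear.FDERIV[OF bounded_bilinear_scaleC, rotated])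
    then show "(h has_derivative (\<lambda>k. k *\<^sub>C ((exp (of_int (- n) * \<zeta>) * exp \<zeta>) *\<^sub>C D (exp \<zeta>) +
        (of_int (- n) * exp (of_int (- n) * \<zeta>)) *\<^sub>C F (exp \<zeta>)))) (at \<zeta>)"
      by (simp add: scaleC_add_right scaleC_scaleC mult_ac)
  next
    have "continuous_on {\<zeta>. Re \<zeta> \<in> U} (\<lambda>\<zeta>. D (exp \<zeta>))" "continuous_on {\<zeta>. Re \<zeta> \<in> U} (\<lambda>\<zeta>. F (exp \<zeta>))"
      by (auto intro!: continuous_intros continuous_on_compose2[OF cont] continuous_on_compose2[OF cont_F]
          simp: U_def)
    then show "continuous_on {\<zeta>. Re \<zeta> \<in> U} (\<lambda>\<zeta>. (exp (of_int (- n) * \<zeta>) * exp \<zeta>) *\<^sub>C D (exp \<zeta>) +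
        (of_int (- n) * exp (of_int (- n) * \<zeta>)) *\<^sub>C F (exp \<zeta>))"
      by (intro continuous_intros bounded_bilinear.continuous_on[OF bounded_bilinear_scaleC])
  next
    fix u
    \<comment> \<open>Exponent \<open>- n\<close> gives the periodicity of the scalar factor,
      exponent 1 that of the argument of \<open>F\<close>.\<close>
    show "h (Complex u (2 * pi)) = h (Complex u 0)"
      using exp_of_int_Complex_2pi[of "- n" u] exp_of_int_Complex_2pi[of 1 u] by (simp add: h_def)
  qed
  with assms(3,4) show ?thesis
    unfolding laurent_coeff_def h_def U_def by fastforce
qed

text \<open>For \<open>n \<noteq> 0\<close> the primitive
  \<open>exp (of_int n * \<zeta>) / (of_int n * \<i>)\<close> takes equal values at both ends; for
  \<open>n = 0\<close> the integrand is constant. This extracts the coefficients of a constant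
  function.\<close>

lemma integral_exp_circle:
  "((\<lambda>t. exp (of_int n * Complex u t) *\<^sub>C E) has_integral
      (if n = 0 then (2 * pi) *\<^sub>R E else (0::'a::complex_banach))) {0..2 * pi}"
proof (cases "n = 0")
  case True
  then show ?thesis
    using has_integral_const_real[of E 0 "2 * pi"] by simp
next
  case False
  have "((\<lambda>t. exp (of_int n * Complex u t) / (of_int n * \<i>)) has_vector_derivative
      exp (of_int n * Complex u t)) (at t within {0..2 * pi})" for t
  proof -
    have "((\<lambda>\<zeta>. exp (of_int n * \<zeta>) / (of_int n * \<i>)) has_field_derivative
        exp (of_int n * \<zeta>) / \<i>) (at \<zeta>)" for \<zeta>
      using False by (auto intro!: derivative_eq_intros simp: field_simps)
    note exp = this[unfolded has_field_derivative_def]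
    have line: "((\<lambda>t. Complex u t) has_derivative (\<lambda>k. of_real k * \<i>)) (at t within {0..2 * pi})"
      by (auto simp: Complex_eq intro!: derivative_eq_intros)
    have "exp w / \<i> * (of_real k * \<i>) = k *\<^sub>R exp w" for w k
      by (simp add: scaleR_conv_of_real field_simps)
    with has_derivative_compose[OF line exp] show ?thesis
      by (simp only: has_vector_derivative_def)
  qed
  then have "((\<lambda>t. exp (of_int n * Complex u t)) has_integral
      (exp (of_int n * Complex u (2 * pi)) / (of_int n * \<i>) - exp (of_int n * Complex u 0) / (of_int n * \<i>)))
      {0..2 * pi}"
    by (intro fundamental_theorem_of_calculus) auto
  then have "((\<lambda>t. exp (of_int n * Complex u t)) has_integral 0) {0..2 * pi}"
    by (simp only: exp_of_int_Complex_2pi diff_self)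
  from has_integral_linear[OF this bounded_bilinear.bounded_linear_left[OF bounded_bilinear_scaleC, of E]]
  show ?thesis
    using False by (simp add: o_def)
qed

text \<open>Coefficient comparison in \<open>eq\<close>, by applying the circle mean to both sides.
  The maps \<open>L\<^sub>0\<close> and \<open>L\<^sub>1\<close> stand for composition with the
  pencil coefficients from the left or from the right.\<close>

lemma laurent_coeff_recurrence:
  fixes F :: "complex \<Rightarrow> 'a::complex_banach" and L\<^sub>0 L\<^sub>1 :: "'a \<Rightarrow> 'b::complex_banach"
  assumes cont: "continuous_on {z. cmod z = exp u} F"
    and L\<^sub>0: "bounded_clinear L\<^sub>0" and L\<^sub>1: "bounded_clinear L\<^sub>1"
    and eq: "\<And>z. cmod z = exp u \<Longrightarrow> L\<^sub>0 (F z) + z *\<^sub>C L\<^sub>1 (F z) = E"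
  shows "L\<^sub>0 (laurent_coeff F n u) + L\<^sub>1 (laurent_coeff F (n - 1) u) = (if n = 0 then E else 0)"
proof -
  define g where "g m t = exp (of_int (- m) * Complex u t) *\<^sub>C F (exp (Complex u t))" for m t
  define J where "J m = integral {0..2 * pi} (g m)" for m
  have J: "(g m has_integral J m) {0..2 * pi}" for m
    unfolding J_def g_def
    by (intro integrable_integral integrable_continuous_real continuous_on_circle cont)
  note bl = L\<^sub>0[unfolded bounded_clinear_def, THEN conjunct1] L\<^sub>1[unfolded bounded_clinear_def, THEN conjunct1]
  have lin: "L\<^sub>0 (a *\<^sub>C x) = a *\<^sub>C L\<^sub>0 x" "L\<^sub>1 (a *\<^sub>C x) = a *\<^sub>C L\<^sub>1 x" for a x
    using L\<^sub>0 L\<^sub>1 by (auto simp: bounded_clinear_def)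
  have "((\<lambda>t. (L\<^sub>0 \<circ> g n) t + (L\<^sub>1 \<circ> g (n - 1)) t) has_integral (L\<^sub>0 (J n) + L\<^sub>1 (J (n - 1)))) {0..2 * pi}"
    by (intro has_integral_add has_integral_linear[OF J] bl)
  moreover have "(L\<^sub>0 \<circ> g n) t + (L\<^sub>1 \<circ> g (n - 1)) t = exp (of_int (- n) * Complex u t) *\<^sub>C E" for t
  proof -
    \<comment> \<open>The factor \<open>z\<close> in front of \<open>L\<^sub>1\<close> lowers the
      coefficient index by one.\<close>
    have "exp (of_int (- (n - 1)) * Complex u t) = exp (of_int (- n) * Complex u t) * exp (Complex u t)"
      by (simp add: algebra_simps flip: exp_add)
    then have "(L\<^sub>0 \<circ> g n) t + (L\<^sub>1 \<circ> g (n - 1)) t = exp (of_int (- n) * Complex u t) *\<^sub>C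
        (L\<^sub>0 (F (exp (Complex u t))) + exp (Complex u t) *\<^sub>C L\<^sub>1 (F (exp (Complex u t))))"
      by (simp only: g_def o_def lin scaleC_add_right scaleC_scaleC)
    then show ?thesis
      by (simp only: eq[OF cmod_exp_Complex])
  qed
  ultimately have "L\<^sub>0 (J n) + L\<^sub>1 (J (n - 1)) = (if n = 0 then (2 * pi) *\<^sub>R E else 0)"
    using integral_exp_circle[of "- n" u E] by (auto intro: has_integral_unique)
  then have "(1 / (2 * pi)) *\<^sub>R L\<^sub>0 (J n) + (1 / (2 * pi)) *\<^sub>R L\<^sub>1 (J (n - 1)) = (if n = 0 then E else 0)"
    by (simp flip: scaleR_add_right)
  then show ?thesis
    unfolding laurent_coeff_def J_def g_def
    by (simp only: linear_scale[OF bounded_linear.linear[OF bl(1)]] linear_scale[OF bounded_linear.linear[OF bl(2)]])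
qed

section \<open>Algebra of the Laurent coefficients\<close>

text \<open>Collects what is kept of the resolvent: coefficient comparison on both sides, and Cauchy
  estimates for one and the same sequence at every radius of the annulus.\<close>

locale laurent_coefficients =
  fixes A\<^sub>0 A\<^sub>1 :: "'h::complex_normed_vector \<Rightarrow>\<^sub>C\<^sub>L 'k::complex_normed_vector"
    and c :: "int \<Rightarrow> 'k \<Rightarrow>\<^sub>C\<^sub>L 'h" and s r :: real
  assumes radii: "0 \<le> s" "s < r"
    and right: "A\<^sub>0 o\<^sub>C c n + A\<^sub>1 o\<^sub>C c (n - 1) = (if n = 0 then cblinfun_id else 0)"
    and left: "c n o\<^sub>C A\<^sub>0 + c (n - 1) o\<^sub>C A\<^sub>1 = (if n = 0 then cblinfun_id else 0)"
    and bound: "s < \<rho> \<Longrightarrow> \<rho> < r \<Longrightarrow> \<exists>B. \<forall>n. norm (c n) \<le> B * \<rho> powi (- n)"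
begin

text \<open>Expand \<open>c m o\<^sub>C (pencil) o\<^sub>C c n\<close> by \<open>right\<close> and
  by \<open>left\<close> and eliminate the common term \<open>c m A\<^sub>0 c n\<close>. The
  conditional terms come from the identity at index 0.\<close>

lemma shift:
  "c m o\<^sub>C A\<^sub>1 o\<^sub>C c (n - 1) + (if m = 0 then c n else 0) =
    c (m - 1) o\<^sub>C A\<^sub>1 o\<^sub>C c n + (if n = 0 then c m else 0)"
proof -
  have "c m o\<^sub>C (A\<^sub>0 o\<^sub>C c n + A\<^sub>1 o\<^sub>C c (n - 1)) = (if n = 0 then c m else 0)"
    by (simp only: right) (simp add: cblinfun_compose_simps)
  then have n: "(if n = 0 then c m else 0) = c m o\<^sub>C A\<^sub>0 o\<^sub>C c n + c m o\<^sub>C A\<^sub>1 o\<^sub>C c (n - 1)"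
    by (simp only: cblinfun_compose_simps cblinfun_compose_assoc)
  have "(c m o\<^sub>C A\<^sub>0 + c (m - 1) o\<^sub>C A\<^sub>1) o\<^sub>C c n = (if m = 0 then c n else 0)"
    by (simp only: left) (simp add: cblinfun_compose_simps)
  then have m: "(if m = 0 then c n else 0) = c m o\<^sub>C A\<^sub>0 o\<^sub>C c n + c (m - 1) o\<^sub>C A\<^sub>1 o\<^sub>C c n"
    by (simp only: cblinfun_compose_simps)
  show ?thesis
    unfolding n m by (simp add: ac_simps)
qed

lemma radii_exist: "\<exists>\<rho> \<rho>'. s < \<rho> \<and> \<rho> < \<rho>' \<and> \<rho>' < r \<and> 0 < \<rho>"
  using radii by (metis dense le_less_trans)

text \<open>The negative index decreases and the nonnegative one increases, so \<open>shift\<close>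
  is only used where its conditional terms are zero. The smaller radius bounds the negative
  coefficient and the larger one the other, so the product decays like
  \<open>(\<rho> / \<rho>') ^ k\<close>.\<close>

lemma products_vanish:
  assumes "i < 0" and "0 \<le> j"
  shows "c i o\<^sub>C A\<^sub>1 o\<^sub>C c j = 0" and "c j o\<^sub>C A\<^sub>1 o\<^sub>C c i = 0"
proof -
  obtain \<rho> \<rho>' where \<rho>: "s < \<rho>" "\<rho> < \<rho>'" "\<rho>' < r" "0 < \<rho>"
    using radii_exist by blast
  obtain B where B: "\<And>n. norm (c n) \<le> B * \<rho> powi (- n)"
    using bound[of \<rho>] \<rho> by auto
  obtain B' where B': "\<And>n. norm (c n) \<le> B' * \<rho>' powi (- n)"
    using bound[of \<rho>'] \<rho> by auto
  define M where "M = (B * \<rho> powi (- i)) * (B' * \<rho>' powi (- j))"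
  have prod: "norm (c (i - int k)) * norm (c (j + int k)) \<le> M * (\<rho> / \<rho>') ^ k" for k
  proof -
    have "norm (c (i - int k)) * norm (c (j + int k)) \<le>
        (B * \<rho> powi (- (i - int k))) * (B' * \<rho>' powi (- (j + int k)))"
      by (intro mult_mono B B' order_trans[OF norm_ge_zero B]) simp
    also have "\<rho> powi (- (i - int k)) = \<rho> powi (- i) * \<rho> ^ k"
      using \<rho> by (simp add: power_int_diff power_int_minus field_simps)
    also have "\<rho>' powi (- (j + int k)) = \<rho>' powi (- j) / \<rho>' ^ k"
      using \<rho> power_int_diff[of \<rho>' "- j" "int k"] by simp
    finally show ?thesis
      by (simp add: M_def power_divide mult_ac)
  qed
  have "(\<lambda>k. norm A\<^sub>1 * (M * (\<rho> / \<rho>') ^ k)) \<longlonglongrightarrow> norm A\<^sub>1 * (M * 0)"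
    using \<rho> by (intro tendsto_intros LIMSEQ_realpow_zero) auto
  then have lim: "(\<lambda>k. norm A\<^sub>1 * (M * (\<rho> / \<rho>') ^ k)) \<longlonglongrightarrow> 0"
    by simp
  have triple: "norm (f o\<^sub>C A\<^sub>1 o\<^sub>C g) \<le> norm A\<^sub>1 * (norm f * norm g)" for f g :: "'k \<Rightarrow>\<^sub>C\<^sub>L 'h"
    using norm_cblinfun_compose[of "f o\<^sub>C A\<^sub>1" g]
      mult_right_mono[OF norm_cblinfun_compose[of f A\<^sub>1], of "norm g"] by (simp add: mult_ac)
  have eq: "c i o\<^sub>C A\<^sub>1 o\<^sub>C c j = c (i - int k) o\<^sub>C A\<^sub>1 o\<^sub>C c (j + int k)" for k
  proof (induction k)
    case (Suc k)
    with shift[of "i - int k" "j + int k + 1"] show ?case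
      using assms by (simp add: algebra_simps)
  qed simp
  have "norm (c i o\<^sub>C A\<^sub>1 o\<^sub>C c j) \<le> norm A\<^sub>1 * (M * (\<rho> / \<rho>') ^ k)" for k
    unfolding eq[of k]
    by (rule order_trans[OF triple]) (intro mult_left_mono prod norm_ge_zero)
  then have "norm (c i o\<^sub>C A\<^sub>1 o\<^sub>C c j) \<le> 0"
    by (intro LIMSEQ_le_const[OF lim]) auto
  then show "c i o\<^sub>C A\<^sub>1 o\<^sub>C c j = 0"
    by simp
  have eq: "c j o\<^sub>C A\<^sub>1 o\<^sub>C c i = c (j + int k) o\<^sub>C A\<^sub>1 o\<^sub>C c (i - int k)" for k
  proof (induction k)
    case (Suc k)
    with shift[of "j + int k + 1" "i - int k"] show ?case
      using assms by (simp add: algebra_simps)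
  qed simp
  have "norm (c j o\<^sub>C A\<^sub>1 o\<^sub>C c i) \<le> norm A\<^sub>1 * (M * (\<rho> / \<rho>') ^ k)" for k
    unfolding eq[of k]
    by (rule order_trans[OF triple]) (intro mult_left_mono prod norm_ge_zero, simp add: prod mult.commute)
  then have "norm (c j o\<^sub>C A\<^sub>1 o\<^sub>C c i) \<le> 0"
    by (intro LIMSEQ_le_const[OF lim]) auto
  then show "c j o\<^sub>C A\<^sub>1 o\<^sub>C c i = 0"
    by simp
qed

text \<open>For \<open>k = 0\<close>, \<open>shift\<close> at \<open>n = 0\<close> contributes
  \<open>c i\<close> itself, as the other product vanishes. Each further step lowers
  \<open>i\<close> by one, hence the induction over arbitrary \<open>i\<close>.\<close>

lemma products_negative: "i < 0 \<Longrightarrow> c i o\<^sub>C A\<^sub>1 o\<^sub>C c (- 1 - int k) = c (i - int k)"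
proof (induction k arbitrary: i)
  case 0
  then show ?case
    using shift[of i 0] products_vanish(1)[of "i - 1" 0] by simp
next
  case (Suc k)
  then show ?case
    using shift[of i "- 1 - int k"] Suc.IH[of "i - 1"] by (simp add: algebra_simps)
qed

lemma sum_h: "c (- 1) o\<^sub>C A\<^sub>1 + c 0 o\<^sub>C A\<^sub>0 = cblinfun_id"
  using left[of 0] by (simp add: add.commute)

lemma sum_k: "A\<^sub>1 o\<^sub>C c (- 1) + A\<^sub>0 o\<^sub>C c 0 = cblinfun_id"
  using right[of 0] by (simp add: add.commute)

text \<open>For \<open>A\<^sub>1\<close> this is \<open>products_vanish\<close>. For
  \<open>A\<^sub>0\<close>, compose the two sum identities with \<open>c (- 1)\<close>: idempotence
  \<open>c (- 1) A\<^sub>1 c (- 1) = c (- 1)\<close> uses up the other summand.\<close>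

lemma annihilate:
  assumes "A \<in> {A\<^sub>0, A\<^sub>1}"
  shows "c (- 1) o\<^sub>C A o\<^sub>C c 0 = 0 \<and> c 0 o\<^sub>C A o\<^sub>C c (- 1) = 0"
proof -
  have idem: "c (- 1) o\<^sub>C A\<^sub>1 o\<^sub>C c (- 1) = c (- 1)"
    using products_negative[of "- 1" 0] by simp
  have "c (- 1) o\<^sub>C (A\<^sub>1 o\<^sub>C c (- 1) + A\<^sub>0 o\<^sub>C c 0) = c (- 1)"
    by (simp add: sum_k)
  then have "c (- 1) o\<^sub>C A\<^sub>0 o\<^sub>C c 0 = 0"
    using idem by (simp add: cblinfun_compose_simps cblinfun_compose_assoc)
  moreover have "(c (- 1) o\<^sub>C A\<^sub>1 + c 0 o\<^sub>C A\<^sub>0) o\<^sub>C c (- 1) = c (- 1)"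
    by (simp add: sum_h)
  then have "c 0 o\<^sub>C A\<^sub>0 o\<^sub>C c (- 1) = 0"
    using idem by (simp add: cblinfun_compose_simps)
  ultimately show ?thesis
    using assms products_vanish[of "- 1" 0] by auto
qed

text \<open>A further factor turns \<open>A\<^sub>0 c (- 1 - k)\<close> into
  \<open>- A\<^sub>1 c (- 2 - k)\<close> by \<open>right\<close>, and
  \<open>products_negative\<close> absorbs \<open>c (- 1) A\<^sub>1\<close>.\<close>

lemma power_singular:
  "cblinfun_power (c (- 1) o\<^sub>C A\<^sub>0) (Suc k) = (- 1) ^ k *\<^sub>C (c (- 1 - int k) o\<^sub>C A\<^sub>0)"
proof (induction k)
  case (Suc k)
  have "A\<^sub>0 o\<^sub>C c (- 1 - int k) = - (A\<^sub>1 o\<^sub>C c (- 1 - int (Suc k)))"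
    using right[of "- 1 - int k"] by (simp add: eq_neg_iff_add_eq_0 algebra_simps)
  then have "c (- 1) o\<^sub>C A\<^sub>0 o\<^sub>C c (- 1 - int k) = - c (- 1 - int (Suc k))"
    using products_negative[of "- 1" "Suc k"]
    by (simp flip: cblinfun_compose_assoc add: cblinfun_compose_simps)
  then have "(c (- 1) o\<^sub>C A\<^sub>0) o\<^sub>C (c (- 1 - int k) o\<^sub>C A\<^sub>0) = - (c (- 1 - int (Suc k)) o\<^sub>C A\<^sub>0)"
    by (simp add: cblinfun_compose_assoc cblinfun_compose_simps)
  then show ?case
    by (subst cblinfun_power.simps, subst Suc)
      (simp add: cblinfun_compose_simps scaleC_minus_left scaleC_minus_right)
qed simp

text \<open>A further factor turns \<open>A\<^sub>1 c k\<close> into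
  \<open>- A\<^sub>0 c (k + 1)\<close> by \<open>right\<close>; then \<open>c 0 A\<^sub>0\<close>
  acts as the identity on \<open>c (k + 1)\<close>, because \<open>c (- 1) A\<^sub>1\<close>
  annihilates it.\<close>

lemma power_regular:
  "cblinfun_power (c 0 o\<^sub>C A\<^sub>1) (Suc k) = (- 1) ^ k *\<^sub>C (c (int k) o\<^sub>C A\<^sub>1)"
proof (induction k)
  case (Suc k)
  have "A\<^sub>1 o\<^sub>C c (int k) = - (A\<^sub>0 o\<^sub>C c (int (Suc k)))"
    using right[of "int (Suc k)"] by (simp add: eq_neg_iff_add_eq_0 algebra_simps)
  then have "c 0 o\<^sub>C A\<^sub>1 o\<^sub>C c (int k) = - (c 0 o\<^sub>C A\<^sub>0 o\<^sub>C c (int (Suc k)))"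
    by (simp flip: cblinfun_compose_assoc add: cblinfun_compose_simps)
  moreover have "(c (- 1) o\<^sub>C A\<^sub>1 + c 0 o\<^sub>C A\<^sub>0) o\<^sub>C c (int (Suc k)) = c (int (Suc k))"
    by (simp add: sum_h)
  then have "c 0 o\<^sub>C A\<^sub>0 o\<^sub>C c (int (Suc k)) = c (int (Suc k))"
    using products_vanish(1)[of "- 1" "int (Suc k)"] by (simp add: cblinfun_compose_simps)
  ultimately have "(c 0 o\<^sub>C A\<^sub>1) o\<^sub>C (c (int k) o\<^sub>C A\<^sub>1) = - (c (int (Suc k)) o\<^sub>C A\<^sub>1)"
    by (simp add: cblinfun_compose_assoc cblinfun_compose_simps)
  then show ?case
    by (subst cblinfun_power.simps, subst Suc)
      (simp add: cblinfun_compose_simps scaleC_minus_left scaleC_minus_right)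
qed simp

lemma norm_power_le:
  assumes "\<rho> > s" "\<rho> < r"
  shows "\<exists>B. \<forall>n. norm (cblinfun_power (c (- 1) o\<^sub>C A\<^sub>0) n) \<le> B * \<rho> ^ n"
    and "\<exists>B. \<forall>n. norm (cblinfun_power (c 0 o\<^sub>C A\<^sub>1) n) \<le> B * (1 / \<rho>) ^ n"
proof -
  have "\<rho> > 0"
    using assms radii by simp
  obtain B where B: "\<And>n. norm (c n) \<le> B * \<rho> powi (- n)"
    using bound[of \<rho>] assms by auto
  have "B \<ge> 0"
    using order_trans[OF norm_ge_zero B[of 0]] by simp
  \<comment> \<open>The closed forms start at exponent 1; the norm of the identity accounts for
    exponent 0.\<close>
  have bd: "norm (cblinfun_power T n) \<le> (norm (cblinfun_id :: 'h \<Rightarrow>\<^sub>C\<^sub>L 'h) + C) * q ^ n"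
    if "\<And>k. norm (cblinfun_power T (Suc k)) \<le> C * q ^ Suc k" "0 \<le> C" "0 \<le> q"
    for T :: "'h \<Rightarrow>\<^sub>C\<^sub>L 'h" and C q n
  proof (cases n)
    case (Suc k)
    show ?thesis
      unfolding Suc by (rule order_trans[OF that(1)]) (intro mult_right_mono, use that in auto)
  qed (use that in auto)
  have 1: "norm (cblinfun_power (c (- 1) o\<^sub>C A\<^sub>0) (Suc k)) \<le> (B * norm A\<^sub>0) * \<rho> ^ Suc k" for k
  proof -
    have "norm (cblinfun_power (c (- 1) o\<^sub>C A\<^sub>0) (Suc k)) \<le> norm (c (- 1 - int k)) * norm A\<^sub>0"
      by (simp only: power_singular norm_scaleC norm_power) (simp add: norm_cblinfun_compose)
    also have "\<dots> \<le> (B * \<rho> powi (- (- 1 - int k))) * norm A\<^sub>0"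
      by (intro mult_right_mono B) simp
    also have "- (- 1 - int k) = int (Suc k)"
      by simp
    finally show ?thesis
      by (simp only: power_int_of_nat mult_ac)
  qed
  show "\<exists>B. \<forall>n. norm (cblinfun_power (c (- 1) o\<^sub>C A\<^sub>0) n) \<le> B * \<rho> ^ n"
    using bd[OF 1] \<open>\<rho> > 0\<close> \<open>B \<ge> 0\<close> by auto
  \<comment> \<open>The power \<open>Suc k\<close> involves the coefficient of index
    \<open>k\<close>; the extra factor \<open>\<rho>\<close> makes up for the difference.\<close>
  have 2: "norm (cblinfun_power (c 0 o\<^sub>C A\<^sub>1) (Suc k)) \<le> (B * norm A\<^sub>1 * \<rho>) * (1 / \<rho>) ^ Suc k" for k
  proof -
    have "norm (cblinfun_power (c 0 o\<^sub>C A\<^sub>1) (Suc k)) \<le> norm (c (int k)) * norm A\<^sub>1"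
      by (simp only: power_regular norm_scaleC norm_power) (simp add: norm_cblinfun_compose)
    also have "\<dots> \<le> (B * \<rho> powi (- int k)) * norm A\<^sub>1"
      by (intro mult_right_mono B) simp
    also have "\<dots> = (B * norm A\<^sub>1 * \<rho>) * (1 / \<rho>) ^ Suc k"
      using \<open>\<rho> > 0\<close> by (simp add: power_int_minus power_divide field_simps)
    finally show ?thesis .
  qed
  show "\<exists>B. \<forall>n. norm (cblinfun_power (c 0 o\<^sub>C A\<^sub>1) n) \<le> B * (1 / \<rho>) ^ n"
    using bd[OF 2] \<open>\<rho> > 0\<close> \<open>B \<ge> 0\<close> by auto
qed

text \<open>Each intermediate radius \<open>\<rho>\<close> bounds the root limits by
  \<open>\<rho>\<close> and \<open>1 / \<rho>\<close>; the sharp bounds follow as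
  \<open>\<rho>\<close> approaches \<open>s\<close> or \<open>r\<close>.\<close>

lemma basic_solution_coefficients: "basic_solution A\<^sub>0 A\<^sub>1 s r (c (- 1)) (c 0)"
proof -
  obtain a where a: "(\<lambda>j. root j (norm (cblinfun_power (c (- 1) o\<^sub>C A\<^sub>0) j))) \<longlonglongrightarrow> a"
    using root_norm_power_convergent by blast
  obtain b where b: "(\<lambda>j. root j (norm (cblinfun_power (c 0 o\<^sub>C A\<^sub>1) j))) \<longlonglongrightarrow> b"
    using root_norm_power_convergent by blast
  have "a \<le> \<rho>" if "s < \<rho>" "\<rho> < r" for \<rho>
    using norm_power_le(1)[OF that] root_norm_power_limit_le[OF a] that radii by fastforce
  then have "a \<le> s"
    using radii(2) by (rule dense_ge_bounded[rotated])
  moreover have "b \<le> 1 / r"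
  proof (rule ccontr)
    assume "\<not> b \<le> 1 / r"
    then have "b > 0"
      using radii by (intro less_trans[of 0 "1 / r" b]) auto
    have "1 / b < r"
      using \<open>\<not> b \<le> 1 / r\<close> \<open>b > 0\<close> radii by (simp add: field_simps)
    \<comment> \<open>Any admissible radius beyond \<open>1 / b\<close> contradicts
      \<open>b \<le> 1 / \<rho>\<close>.\<close>
    then obtain \<rho> where \<rho>: "max s (1 / b) < \<rho>" "\<rho> < r"
      using radii dense[of "max s (1 / b)" r] by auto
    have "b \<le> 1 / \<rho>"
      using norm_power_le(2)[of \<rho>] root_norm_power_limit_le[OF b, of _ "1 / \<rho>"] \<rho> radii by force
    moreover have "\<rho> > 0"
      using \<rho> radii by simp
    ultimately have "\<rho> \<le> 1 / b"
      using \<open>b > 0\<close> by (simp add: field_simps)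
    with \<rho> show False
      by simp
  qed
  ultimately show ?thesis
    unfolding basic_solution_def using sum_h sum_k annihilate a b by blast
qed

end

section \<open>Analyticity of the resolvent and existence of a basic solution\<close>

lemma open_annulus: "open (annulus (ereal s) (ereal r))"
  unfolding annulus_def by (simp add: open_Collect_conj open_Collect_less continuous_on_norm_id)

lemma resolvent_is_inverse:
  "cblinfun_invertible (pencil A\<^sub>0 A\<^sub>1 z) \<Longrightarrow>
    cblinfun_is_inverse (pencil A\<^sub>0 A\<^sub>1 z) (resolvent A\<^sub>0 A\<^sub>1 z)"
  unfolding resolvent_def by (rule cblinfun_is_inverse_inv)

lemma resolvent_vanalytic_on:
  assumes "open U" and "\<And>z. z \<in> U \<Longrightarrow> cblinfun_invertible (pencil A\<^sub>0 A\<^sub>1 z)"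
  shows "resolvent A\<^sub>0 A\<^sub>1 vanalytic_on U"
  unfolding vanalytic_on_def vholomorphic_on_def
proof
  fix z assume "z \<in> U"
  then obtain e where e: "e > 0" "ball z e \<subseteq> U"
    using \<open>open U\<close> by (auto simp: open_contains_ball)
  have "\<exists>D. (resolvent A\<^sub>0 A\<^sub>1 has_derivative (\<lambda>h. h *\<^sub>C D)) (at w within ball z e)" if "w \<in> U" for w
    using resolvent_has_derivative[OF \<open>open U\<close> resolvent_is_inverse[OF assms(2)] that]
    by (blast intro: has_derivative_at_withinI)
  with e show "\<exists>e>0. \<forall>w\<in>ball z e.
      \<exists>D. (resolvent A\<^sub>0 A\<^sub>1 has_derivative (\<lambda>h. h *\<^sub>C D)) (at w within ball z e)"
    by blast
qed

lemma basic_solution_exists: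
  fixes A\<^sub>0 A\<^sub>1 :: "'h::complex_banach \<Rightarrow>\<^sub>C\<^sub>L 'k::complex_banach"
  assumes s: "0 \<le> s" "s < r"
    and inv: "\<And>z. z \<in> annulus (ereal s) (ereal r) \<Longrightarrow> cblinfun_invertible (pencil A\<^sub>0 A\<^sub>1 z)"
  shows "\<exists>Rm R\<^sub>0. basic_solution A\<^sub>0 A\<^sub>1 s r Rm R\<^sub>0"
proof -
  define R where "R = resolvent A\<^sub>0 A\<^sub>1"
  define U where "U = {z. cmod z \<in> {s<..<r}}"
  have U: "U = annulus (ereal s) (ereal r)"
    by (auto simp: U_def annulus_real_iff)
  then have "open U"
    by (simp add: open_annulus)
  have Rinv: "cblinfun_is_inverse (pencil A\<^sub>0 A\<^sub>1 z) (R z)" if "z \<in> U" for z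
    using that inv by (simp add: R_def U resolvent_is_inverse)
  have der: "(R has_derivative (\<lambda>h. h *\<^sub>C (- (R z o\<^sub>C A\<^sub>1 o\<^sub>C R z)))) (at z)" if "cmod z \<in> {s<..<r}" for z
    using resolvent_has_derivative[OF \<open>open U\<close> Rinv] that by (simp add: U_def)
  have cont: "continuous_on U R"
    using resolvent_isCont[OF \<open>open U\<close> Rinv] by (auto intro: continuous_at_imp_continuous_on)
  then have cont': "continuous_on U (\<lambda>z. - (R z o\<^sub>C A\<^sub>1 o\<^sub>C R z))"
    by (intro continuous_intros bounded_bilinear.continuous_on[OF bounded_bilinear_cblinfun_compose])
  \<comment> \<open>An arbitrary reference circle defines the coefficients and yields both
    recurrences; independence of the radius transfers the Cauchy estimates from every other
    circle.\<close>
  obtain \<rho>\<^sub>0 where \<rho>\<^sub>0: "s < \<rho>\<^sub>0" "\<rho>\<^sub>0 < r"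
    using dense s by blast
  define u where "u = ln \<rho>\<^sub>0"
  have u: "exp u \<in> {s<..<r}"
    using \<rho>\<^sub>0 s by (simp add: u_def)
  define c where "c n = laurent_coeff R n u" for n
  have circle: "{z. cmod z = exp v} \<subseteq> U" if "exp v \<in> {s<..<r}" for v
    using that by (auto simp: U_def)
  note cont_circle = continuous_on_subset[OF cont circle]
  have "laurent_coefficients A\<^sub>0 A\<^sub>1 c s r"
  proof
    show "0 \<le> s" "s < r"
      by fact+
    have clin: "bounded_clinear (\<lambda>X :: 'k \<Rightarrow>\<^sub>C\<^sub>L 'h. A o\<^sub>C X)" for A :: "'h \<Rightarrow>\<^sub>C\<^sub>L 'k"
      by (simp add: bounded_clinear_def cblinfun_compose_simps
          bounded_bilinear.bounded_linear_right[OF bounded_bilinear_cblinfun_compose])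
    have clin': "bounded_clinear (\<lambda>X :: 'k \<Rightarrow>\<^sub>C\<^sub>L 'h. X o\<^sub>C A)" for A :: "'h \<Rightarrow>\<^sub>C\<^sub>L 'k"
      by (simp add: bounded_clinear_def cblinfun_compose_simps
          bounded_bilinear.bounded_linear_left[OF bounded_bilinear_cblinfun_compose])
    have inv_circle: "cblinfun_invertible (pencil A\<^sub>0 A\<^sub>1 z)" if "cmod z = exp u" for z
      using inv[folded U] that u by (auto simp: U_def)
    fix n
    show "A\<^sub>0 o\<^sub>C c n + A\<^sub>1 o\<^sub>C c (n - 1) = (if n = 0 then cblinfun_id else 0)"
      unfolding c_def using pencil_resolvent(2)[OF inv_circle]
      by (intro laurent_coeff_recurrence cont_circle u clin) (simp add: R_def)
    show "c n o\<^sub>C A\<^sub>0 + c (n - 1) o\<^sub>C A\<^sub>1 = (if n = 0 then cblinfun_id else 0)"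
      unfolding c_def using pencil_resolvent(1)[OF inv_circle]
      by (intro laurent_coeff_recurrence[where L\<^sub>0 = "\<lambda>X. X o\<^sub>C A\<^sub>0" and L\<^sub>1 = "\<lambda>X. X o\<^sub>C A\<^sub>1"] cont_circle u clin')
        (simp add: R_def)
    fix \<rho> assume \<rho>: "s < \<rho>" "\<rho> < r"
    then have v: "exp (ln \<rho>) \<in> {s<..<r}" "exp (ln \<rho>) = \<rho>"
      using s by auto
    have "c n = laurent_coeff R n (ln \<rho>)" for n
      unfolding c_def by (rule laurent_coeff_constant[OF der cont'[unfolded U_def] u v(1)])
    then show "\<exists>B. \<forall>n. norm (c n) \<le> B * \<rho> powi (- n)"
      using laurent_coeff_bound[OF cont_circle[OF v(1)]] v(2) by simp
  qed
  then show ?thesis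
    using laurent_coefficients.basic_solution_coefficients by blast
qed

text \<open>Inversion swaps the two radii. The case \<open>s = 0\<close> is separate because the
  outer bound is then infinite.\<close>

lemma reciprocal_in_annulus:
  assumes "0 \<le> s" "s < r" "l \<in> annulus (inverse (ereal r)) (inverse (ereal s))"
  shows "l \<noteq> 0" and "- inverse l \<in> annulus (ereal s) (ereal r)"
proof -
  have "r > 0"
    using assms by simp
  have l: "1 / r < cmod l" "s = 0 \<or> cmod l < 1 / s"
    using assms by (auto simp: annulus_def divide_inverse split: if_splits)
  show "l \<noteq> 0"
    using l(1) \<open>r > 0\<close> by (auto simp: field_simps)
  then show "- inverse l \<in> annulus (ereal s) (ereal r)"
    using l \<open>r > 0\<close> assms(1) by (cases "s = 0") (auto simp: annulus_real_iff norm_inverse norm_divide field_simps)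
qed

theorem corollary2:
  fixes A\<^sub>0 A\<^sub>1 :: "'h::complex_banach \<Rightarrow>\<^sub>C\<^sub>L 'k::complex_banach"
    and s r :: real
  assumes "\<not> cblinfun_invertible A\<^sub>0" and "0 \<le> s" and "s < r"
  shows
    "((\<forall>z\<in>annulus (ereal s) (ereal r). cblinfun_invertible (pencil A\<^sub>0 A\<^sub>1 z)) \<and>
        resolvent A\<^sub>0 A\<^sub>1 vanalytic_on annulus (ereal s) (ereal r)
      \<longleftrightarrow> (\<exists>Rm R\<^sub>0. basic_solution A\<^sub>0 A\<^sub>1 s r Rm R\<^sub>0)) \<and>
    (\<forall>Rm R\<^sub>0. basic_solution A\<^sub>0 A\<^sub>1 s r Rm R\<^sub>0 \<longrightarrow>
      (\<forall>Rm' R\<^sub>0'. basic_solution A\<^sub>0 A\<^sub>1 s r Rm' R\<^sub>0' \<longrightarrow> Rm' = Rm \<and> R\<^sub>0' = R\<^sub>0) \<and>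
      (let R = resolvent A\<^sub>0 A\<^sub>1; P = Rm o\<^sub>C A\<^sub>1; Q = A\<^sub>1 o\<^sub>C Rm;
           Rsing = (\<lambda>z. P o\<^sub>C R z o\<^sub>C Q);
           Rreg = (\<lambda>z. (cblinfun_id - P) o\<^sub>C R z o\<^sub>C (cblinfun_id - Q))
       in \<forall>z\<in>annulus (ereal s) (ereal r).
            R z = Rsing z + Rreg z \<and>
            cblinfun_invertible (z *\<^sub>C cblinfun_id + Rm o\<^sub>C A\<^sub>0) \<and>
            Rsing z = cblinfun_inv (z *\<^sub>C cblinfun_id + Rm o\<^sub>C A\<^sub>0) o\<^sub>C Rm \<and>
            cblinfun_invertible (cblinfun_id + z *\<^sub>C (R\<^sub>0 o\<^sub>C A\<^sub>1)) \<and>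
            Rreg z = cblinfun_inv (cblinfun_id + z *\<^sub>C (R\<^sub>0 o\<^sub>C A\<^sub>1)) o\<^sub>C R\<^sub>0) \<and>
      (let Rl = (\<lambda>l. inverse l *\<^sub>C (resolvent A\<^sub>0 A\<^sub>1 (- inverse l) o\<^sub>C A\<^sub>0));
           Sl = (\<lambda>l. inverse l *\<^sub>C (A\<^sub>0 o\<^sub>C resolvent A\<^sub>0 A\<^sub>1 (- inverse l)))
       in \<forall>l\<in>annulus (inverse (ereal r)) (inverse (ereal s)).
          \<forall>m\<in>annulus (inverse (ereal r)) (inverse (ereal s)).
            Rl l - Rl m = (m - l) *\<^sub>C (Rl l o\<^sub>C Rl m) \<and>
            Sl l - Sl m = (m - l) *\<^sub>C (Sl l o\<^sub>C Sl m)))"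
proof (intro conjI allI impI)
  note s = \<open>0 \<le> s\<close> \<open>s < r\<close>
  show "(\<forall>z\<in>annulus (ereal s) (ereal r). cblinfun_invertible (pencil A\<^sub>0 A\<^sub>1 z)) \<and>
        resolvent A\<^sub>0 A\<^sub>1 vanalytic_on annulus (ereal s) (ereal r)
      \<longleftrightarrow> (\<exists>Rm R\<^sub>0. basic_solution A\<^sub>0 A\<^sub>1 s r Rm R\<^sub>0)"
    using basic_solution_exists[OF s] basic_solution_resolvent(3)[OF s]
      resolvent_vanalytic_on[OF open_annulus] by blast
  fix Rm R\<^sub>0 assume sol: "basic_solution A\<^sub>0 A\<^sub>1 s r Rm R\<^sub>0"
  show "Rm' = Rm" "R\<^sub>0' = R\<^sub>0" if "basic_solution A\<^sub>0 A\<^sub>1 s r Rm' R\<^sub>0'" for Rm' R\<^sub>0'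
    using basic_solution_unique[OF s sol that] by auto
  note res = basic_solution_resolvent[OF s sol]
  show "let R = resolvent A\<^sub>0 A\<^sub>1; P = Rm o\<^sub>C A\<^sub>1; Q = A\<^sub>1 o\<^sub>C Rm;
           Rsing = (\<lambda>z. P o\<^sub>C R z o\<^sub>C Q);
           Rreg = (\<lambda>z. (cblinfun_id - P) o\<^sub>C R z o\<^sub>C (cblinfun_id - Q))
       in \<forall>z\<in>annulus (ereal s) (ereal r).
            R z = Rsing z + Rreg z \<and>
            cblinfun_invertible (z *\<^sub>C cblinfun_id + Rm o\<^sub>C A\<^sub>0) \<and>
            Rsing z = cblinfun_inv (z *\<^sub>C cblinfun_id + Rm o\<^sub>C A\<^sub>0) o\<^sub>C Rm \<and>
            cblinfun_invertible (cblinfun_id + z *\<^sub>C (R\<^sub>0 o\<^sub>C A\<^sub>1)) \<and>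
            Rreg z = cblinfun_inv (cblinfun_id + z *\<^sub>C (R\<^sub>0 o\<^sub>C A\<^sub>1)) o\<^sub>C R\<^sub>0"
    unfolding Let_def
  proof (intro ballI conjI)
    fix z assume z: "z \<in> annulus (ereal s) (ereal r)"
    show "resolvent A\<^sub>0 A\<^sub>1 z = Rm o\<^sub>C A\<^sub>1 o\<^sub>C resolvent A\<^sub>0 A\<^sub>1 z o\<^sub>C (A\<^sub>1 o\<^sub>C Rm) +
        (cblinfun_id - Rm o\<^sub>C A\<^sub>1) o\<^sub>C resolvent A\<^sub>0 A\<^sub>1 z o\<^sub>C (cblinfun_id - A\<^sub>1 o\<^sub>C Rm)"
      by (simp only: res(4,5)[OF z]) (rule res(6)[OF z])
  qed (fact res)+
  show "let Rl = (\<lambda>l. inverse l *\<^sub>C (resolvent A\<^sub>0 A\<^sub>1 (- inverse l) o\<^sub>C A\<^sub>0));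
           Sl = (\<lambda>l. inverse l *\<^sub>C (A\<^sub>0 o\<^sub>C resolvent A\<^sub>0 A\<^sub>1 (- inverse l)))
       in \<forall>l\<in>annulus (inverse (ereal r)) (inverse (ereal s)).
          \<forall>m\<in>annulus (inverse (ereal r)) (inverse (ereal s)).
            Rl l - Rl m = (m - l) *\<^sub>C (Rl l o\<^sub>C Rl m) \<and>
            Sl l - Sl m = (m - l) *\<^sub>C (Sl l o\<^sub>C Sl m)"
    \<comment> \<open>The scalars are moved onto the resolvent, so that both families become
      compositions of \<open>B\<close> below with \<open>A\<^sub>0\<close>.\<close>
    unfolding Let_def cblinfun_compose_scaleC(1)[of _ _ A\<^sub>0, symmetric]
      cblinfun_compose_scaleC(2)[of A\<^sub>0, symmetric]
  proof (intro ballI)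
    fix l m assume lm: "l \<in> annulus (inverse (ereal r)) (inverse (ereal s))"
      "m \<in> annulus (inverse (ereal r)) (inverse (ereal s))"
    define B where "B l = inverse l *\<^sub>C resolvent A\<^sub>0 A\<^sub>1 (- inverse l)" for l
    have "B l - B m = (m - l) *\<^sub>C (B l o\<^sub>C A\<^sub>0 o\<^sub>C B m)"
      unfolding B_def
      by (intro reciprocal_resolvent_equation res(3) reciprocal_in_annulus[OF s] lm)
    \<comment> \<open>Composing one equation for \<open>B\<close> with \<open>A\<^sub>0\<close> on
      the right gives the resolvent equation on the domain, and on the left the one on the
      codomain.\<close>
    from arg_cong[OF this, of "\<lambda>X. X o\<^sub>C A\<^sub>0"] arg_cong[OF this, of "\<lambda>X. A\<^sub>0 o\<^sub>C X"]
    have "B l o\<^sub>C A\<^sub>0 - B m o\<^sub>C A\<^sub>0 = (m - l) *\<^sub>C ((B l o\<^sub>C A\<^sub>0) o\<^sub>C (B m o\<^sub>C A\<^sub>0)) \<and>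
      A\<^sub>0 o\<^sub>C B l - A\<^sub>0 o\<^sub>C B m = (m - l) *\<^sub>C ((A\<^sub>0 o\<^sub>C B l) o\<^sub>C (A\<^sub>0 o\<^sub>C B m))"
      by (simp add: cblinfun_compose_simps cblinfun_compose_assoc)
    then show "(inverse l *\<^sub>C resolvent A\<^sub>0 A\<^sub>1 (- inverse l)) o\<^sub>C A\<^sub>0 -
        (inverse m *\<^sub>C resolvent A\<^sub>0 A\<^sub>1 (- inverse m)) o\<^sub>C A\<^sub>0 =
        (m - l) *\<^sub>C (((inverse l *\<^sub>C resolvent A\<^sub>0 A\<^sub>1 (- inverse l)) o\<^sub>C A\<^sub>0) o\<^sub>C
          ((inverse m *\<^sub>C resolvent A\<^sub>0 A\<^sub>1 (- inverse m)) o\<^sub>C A\<^sub>0)) \<and>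
        A\<^sub>0 o\<^sub>C inverse l *\<^sub>C resolvent A\<^sub>0 A\<^sub>1 (- inverse l) -
        A\<^sub>0 o\<^sub>C inverse m *\<^sub>C resolvent A\<^sub>0 A\<^sub>1 (- inverse m) =
        (m - l) *\<^sub>C (A\<^sub>0 o\<^sub>C inverse l *\<^sub>C resolvent A\<^sub>0 A\<^sub>1 (- inverse l) o\<^sub>C
          (A\<^sub>0 o\<^sub>C inverse m *\<^sub>C resolvent A\<^sub>0 A\<^sub>1 (- inverse m)))"
      unfolding B_def .
  qed
qed

end
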